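(* Let $\Omega\subseteq\mathbb{R}^n$ and $f:\Omega\to\mathbb{R}^n$ with $f(0)=0$ and solution map $\phi_f$, let $G\subseteq\Omega$ be forward invariant for $f$, and let $\alpha_1,\alpha_2:G\to\mathbb{R}_+$ be continuous. For $\rho:\mathbb{R}_+\to\mathbb{R}$ continuous on $(0,\infty)$, let $\beta:\mathbb{R}_+\times\mathbb{R}_+\to\mathbb{R}_+$ be the unique continuous function satisfying $\beta(y,0)=y$ and $\partial_t\beta(y,t)=\rho(\beta(y,t))$ for all $y,t\ge0$. Suppose that $\alpha_1$ is positive definite and coercive, that $\beta(y,t)$ is monotonically decreasing in $t$ for $y>0$, and that $f$, $\alpha_1$, and $\beta$ are locally Lipschitz continuous. If $f$ is $\beta$-stable on $G$ with respect to $\alpha_1,\alpha_2$, i.e. $\alpha_1(\phi_f(x,t))\le\beta(\alpha_2(x),t)$ for all $x\in G$, $t\ge0$, then for every $\epsilon\in(0,1)$ there exists a continuous function $V_\epsilon:G\to\mathbb{R}_+$ which is locally Lipschitz continuous on $G\setminus\{0\}$ and differentiable almost everywhere and satisfies $$\alpha_1(x)\le V_\epsilon(x)\le\alpha_2(x)\quad\forall x\in G,\qquad \nabla V_\epsilon(x)^Tf(x)\le(1-\epsilon)\rho(V_\epsilon(x))\quad\text{for a.e. }x\in G.$$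
   Context: $\mathbb{R}_+=[0,\infty)$. For $f:\Omega\to\mathbb{R}^n$, $\phi_f$ denotes the solution map of the ODE: $\partial_t\phi_f(x,t)=f(\phi_f(x,t))$, $\phi_f(x,0)=x$. Standing assumption: $\phi_f$ is well-defined, unique, jointly continuous in $(x,t)$, and satisfies $\phi_f(\phi_f(x,t),s)=\phi_f(x,t+s)$ for $t,s\ge0$. $G\subseteq\Omega$ is forward invariant for $f$ if $\phi_f(x,t)\in G$ for all $x\in G$, $t\ge 0$. $\alpha$ is positive definite if $\alpha(x)=0$ if and only if $x=0$, and coercive if $\|x\|_2\to\infty$ implies $\alpha(x)\to\infty$. "Monotonically decreasing" means strictly decreasing. "The unique continuous function satisfying ..." means that it is assumed that exactly one continuous $\beta$ with the stated properties exists. *)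

theory Defs
  imports "HOL-Analysis.Analysis"
begin

definition locally_lipschitz_on :: "'a::metric_space set \<Rightarrow> ('a \<Rightarrow> 'b::metric_space) \<Rightarrow> bool" where
  "locally_lipschitz_on X g \<longleftrightarrow>
     (\<forall>x\<in>X. \<exists>u>0. \<exists>L. L-lipschitz_on (cball x u \<inter> X) g)"

text \<open>
  This is the autonomous case of \<open>local_lipschitz\<close>, which is phrased for
  time-dependent functions.
\<close>

lemma locally_lipschitz_on_iff_local_lipschitz:
  "locally_lipschitz_on X g \<longleftrightarrow> local_lipschitz (UNIV :: real set) X (\<lambda>_. g)"
proof
  assume "locally_lipschitz_on X g"
  then show "local_lipschitz (UNIV :: real set) X (\<lambda>_. g)"
    unfolding locally_lipschitz_on_def local_lipschitz_def by blast
next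
  assume l: "local_lipschitz (UNIV :: real set) X (\<lambda>_. g)"
  show "locally_lipschitz_on X g"
    unfolding locally_lipschitz_on_def
  proof
    fix x assume "x \<in> X"
    with l obtain u L where u: "u > 0"
      and L: "\<forall>t\<in>cball (0::real) u \<inter> UNIV. L-lipschitz_on (cball x u \<inter> X) g"
      unfolding local_lipschitz_def by blast
    have "(0::real) \<in> cball 0 u \<inter> UNIV" using u by simp
    with u L show "\<exists>u>0. \<exists>L. L-lipschitz_on (cball x u \<inter> X) g" by blast
  qed
qed

definition ode_solution :: "(real^'n) set \<Rightarrow> (real^'n \<Rightarrow> real^'n) \<Rightarrow> real^'n \<Rightarrow> (real \<Rightarrow> real^'n) \<Rightarrow> bool" where
  "ode_solution \<Omega> f x u \<longleftrightarrow>
     u 0 = x \<and>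
     (\<forall>t\<ge>0. u t \<in> \<Omega> \<and> (u has_vector_derivative f (u t)) (at t within {0..}))"

text \<open>
  Functions with domain \<open>\<Omega>\<close>, \<open>G\<close> or \<open>[0,\<infinity>)\<close> are total functions whose values outside the
  domain are unconstrained; time derivatives at \<open>0\<close> are therefore one-sided.
\<close>

definition is_solution_map ::
  "(real^'n) set \<Rightarrow> (real^'n \<Rightarrow> real^'n) \<Rightarrow> (real^'n \<Rightarrow> real \<Rightarrow> real^'n) \<Rightarrow> bool" where
  "is_solution_map \<Omega> f \<phi> \<longleftrightarrow>
     (\<forall>x\<in>\<Omega>. ode_solution \<Omega> f x (\<phi> x)) \<and>
     (\<forall>x\<in>\<Omega>. \<forall>u. ode_solution \<Omega> f x u \<longrightarrow> (\<forall>t\<ge>0. u t = \<phi> x t)) \<and>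
     continuous_on (\<Omega> \<times> {0..}) (\<lambda>(x, t). \<phi> x t) \<and>
     (\<forall>x\<in>\<Omega>. \<forall>t\<ge>0. \<forall>s\<ge>0. \<phi> (\<phi> x t) s = \<phi> x (t + s))"

definition forward_invariant :: "(real^'n \<Rightarrow> real \<Rightarrow> real^'n) \<Rightarrow> (real^'n) set \<Rightarrow> bool" where
  "forward_invariant \<phi> G \<longleftrightarrow> (\<forall>x\<in>G. \<forall>t\<ge>0. \<phi> x t \<in> G)"

definition positive_definite_on :: "(real^'n) set \<Rightarrow> (real^'n \<Rightarrow> real) \<Rightarrow> bool" where
  "positive_definite_on G \<alpha> \<longleftrightarrow> (\<forall>x\<in>G. \<alpha> x = 0 \<longleftrightarrow> x = 0)"

definition coercive_on :: "(real^'n) set \<Rightarrow> (real^'n \<Rightarrow> real) \<Rightarrow> bool" where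
  "coercive_on G \<alpha> \<longleftrightarrow> filterlim \<alpha> at_top (inf at_infinity (principal G))"

definition rate_flow :: "(real \<Rightarrow> real) \<Rightarrow> (real \<Rightarrow> real \<Rightarrow> real) \<Rightarrow> bool" where
  "rate_flow \<rho> \<beta> \<longleftrightarrow>
     continuous_on ({0..} \<times> {0..}) (\<lambda>(y, t). \<beta> y t) \<and>
     (\<forall>y\<ge>0. \<forall>t\<ge>0. \<beta> y t \<ge> 0) \<and>
     (\<forall>y\<ge>0. \<beta> y 0 = y) \<and>
     (\<forall>y\<ge>0. \<forall>t\<ge>0. (\<beta> y has_real_derivative \<rho> (\<beta> y t)) (at t within {0..}))"

definition is_unique_rate_flow :: "(real \<Rightarrow> real) \<Rightarrow> (real \<Rightarrow> real \<Rightarrow> real) \<Rightarrow> bool" where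
  "is_unique_rate_flow \<rho> \<beta> \<longleftrightarrow>
     rate_flow \<rho> \<beta> \<and>
     (\<forall>\<beta>'. rate_flow \<rho> \<beta>' \<longrightarrow> (\<forall>y\<ge>0. \<forall>t\<ge>0. \<beta>' y t = \<beta> y t))"

definition beta_stable_on ::
  "(real^'n) set \<Rightarrow> (real^'n \<Rightarrow> real \<Rightarrow> real^'n) \<Rightarrow> (real \<Rightarrow> real \<Rightarrow> real) \<Rightarrow>
   (real^'n \<Rightarrow> real) \<Rightarrow> (real^'n \<Rightarrow> real) \<Rightarrow> bool" where
  "beta_stable_on G \<phi> \<beta> \<alpha>\<^sub>1 \<alpha>\<^sub>2 \<longleftrightarrow> (\<forall>x\<in>G. \<forall>t\<ge>0. \<alpha>\<^sub>1 (\<phi> x t) \<le> \<beta> (\<alpha>\<^sub>2 x) t)"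

text \<open>
  \<open>G\<close> need not be open. Derivatives are taken within \<open>G\<close>, which at interior points is the usual
  notion. Elsewhere a gradient within \<open>G\<close> need not be unique, so statements about the gradient
  are to be made for every vector \<open>v\<close> with this property.
\<close>

definition has_gradient_within ::
  "(real^'n \<Rightarrow> real) \<Rightarrow> real^'n \<Rightarrow> real^'n \<Rightarrow> (real^'n) set \<Rightarrow> bool" where
  "has_gradient_within V v x G \<longleftrightarrow> (V has_derivative (\<lambda>h. v \<bullet> h)) (at x within G)"

end

theory Submission
  imports Defs
begin

text \<open>
  On \<open>(0, \<infinity>)\<close> the rate \<open>\<rho>\<close> is negative (\<open>rate_negative\<close>), so \<open>1 / \<rho>\<close> has an antiderivative \<open>\<tau>\<close> there.
  In the coordinate \<open>\<tau>\<close> the comparison flow is a translation, \<open>\<tau> (\<beta> y t) = \<tau> y + t\<close>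
  (\<open>rate_time_coordinate\<close>). With \<open>a = \<tau> \<circ> \<alpha>\<^sub>1\<close> and \<open>b = \<tau> \<circ> \<alpha>\<^sub>2\<close>, stability bounds \<open>a\<close>
  along trajectories from below at unit slope: \<open>a (\<phi> x t) \<ge> b x + t\<close>. The function
  \<open>W x = (INF t\<in>{0..}. a (\<phi> x t) - (1 - \<epsilon>) * t)\<close> then lies between \<open>b\<close> and \<open>a\<close>, and
  \<open>W (\<phi> x s) \<ge> W x + (1 - \<epsilon>) * s\<close>, because the trajectory from \<open>\<phi> x s\<close> is a part of the trajectory from \<open>x\<close>.
  Put \<open>V = \<tau>\<^sup>-\<^sup>1 \<circ> W\<close> away from \<open>0\<close>, and \<open>V 0 = 0\<close>. As \<open>\<tau>\<close> is decreasing, \<open>\<alpha>\<^sub>1 \<le> V \<le> \<alpha>\<^sub>2\<close> and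
  \<open>V (\<phi> x s) \<le> \<beta> (V x) ((1 - \<epsilon>) * s)\<close>, with equality at \<open>s = 0\<close>. Differentiating at \<open>s = 0\<close> gives
  \<open>v \<bullet> f x \<le> (1 - \<epsilon>) * \<rho> (V x)\<close> for every gradient \<open>v\<close> of \<open>V\<close> within \<open>G\<close> at every \<open>x \<noteq> 0\<close>.

  The loss of \<open>\<epsilon>\<close> in the rate buys regularity. Since \<open>a (\<phi> x t) - (1 - \<epsilon>) * t \<ge> b x + \<epsilon> * t\<close>, only times
  \<open>t \<le> (a x - b x) / \<epsilon>\<close> matter in the infimum. This bound is locally uniform in \<open>x \<noteq> 0\<close>, and on a bounded
  time interval \<open>\<phi> x t\<close> is Lipschitz in \<open>x\<close> uniformly in \<open>t\<close> (Gronwall,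
  \<open>flow_locally_lipschitz_initial\<close>) and stays away from \<open>0\<close> (Gronwall backwards in time,
  \<open>flow_avoids_equilibrium\<close>). Hence \<open>W\<close>, and with it \<open>V\<close>, is locally Lipschitz away from \<open>0\<close>. Near \<open>0\<close> the
  same lower bound disposes of large times, and on the remaining compact time interval trajectories from
  nearby points stay near \<open>0\<close>, where \<open>a\<close> is large; so \<open>W\<close> tends to infinity and \<open>V\<close> tends to \<open>0\<close>.

  Differentiability almost everywhere is Rademacher's theorem, applied to Lipschitz extensions of \<open>V\<close> from
  small balls. It is proved here in four steps. A Lipschitz function on the line is an indefinite integral, so its
  difference quotients converge almost everywhere. Fubini carries this over to every fixed direction. The
  directional derivatives depend additively on the direction almost everywhere, because the integrals of
  the difference quotients over every box do so in the limit. Finally, linearity on a countable dense set of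
  directions is enough for total differentiability, since the sphere is compact and the function is Lipschitz.
\<close>

section \<open>Lipschitz functions on the real line\<close>

text \<open>
  Adding \<open>(L + 1) * x\<close> to \<open>\<phi>\<close> gives a homeomorphism \<open>F\<close> of the line with a \<open>1\<close>-Lipschitz inverse \<open>\<psi>\<close>. The image
  \<open>\<mu>\<close> of Lebesgue measure under \<open>\<psi>\<close> assigns \<open>F b - F a\<close> to \<open>{a..b}\<close>. It vanishes on null sets because
  \<open>F\<close> is Lipschitz, and its Radon-Nikodym density integrates to \<open>F\<close>; subtracting \<open>L + 1\<close> returns to \<open>\<phi>\<close>.
\<close>

lemma lipschitz_indefinite_integral:
  fixes \<phi> :: "real \<Rightarrow> real"
  assumes lip: "L-lipschitz_on UNIV \<phi>"
  obtains f where "\<And>a b. a \<le> b \<Longrightarrow> (f has_integral (\<phi> b - \<phi> a)) {a..b}"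
proof -
  have L0: "0 \<le> L" using lip by (rule lipschitz_on_nonneg)
  have lipD: "\<bar>\<phi> x - \<phi> y\<bar> \<le> L * \<bar>x - y\<bar>" for x y
    using lipschitz_onD[OF lip, of x y] by (simp add: dist_real_def)
  define F where "F = (\<lambda>x. \<phi> x + (L + 1) * x)"
  have expand: "F b - F a \<ge> b - a" if "a \<le> b" for a b
  proof -
    have "\<phi> b - \<phi> a \<ge> - (L * (b - a))" using lipD[of b a] that by auto
    then show ?thesis unfolding F_def by (simp add: algebra_simps)
  qed
  have contF: "continuous_on UNIV F" unfolding F_def
    by (intro continuous_intros lipschitz_on_continuous_on[OF lip])
  have surj: "\<exists>x. F x = y" for y
  proof -
    define c where "c = \<bar>y - F 0\<bar>"
    have "F (-c) \<le> y" "y \<le> F c"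
      using expand[of "-c" 0] expand[of 0 c] unfolding c_def by auto
    then have "\<exists>x\<ge>-c. x \<le> c \<and> F x = y"
      by (intro IVT') (auto intro: continuous_on_subset[OF contF] simp: c_def)
    then show ?thesis by blast
  qed
  define \<psi> where "\<psi> = (\<lambda>y. SOME x. F x = y)"
  have F\<psi>: "F (\<psi> y) = y" for y unfolding \<psi>_def using someI_ex[OF surj] .
  have Fle: "F a \<le> F b \<longleftrightarrow> a \<le> b" for a b
    using expand[of a b] expand[of b a] by linarith
  have "1-lipschitz_on UNIV \<psi>"
  proof (rule lipschitz_onI)
    fix y z
    consider "\<psi> y \<le> \<psi> z" | "\<psi> z \<le> \<psi> y" by linarith
    then show "dist (\<psi> y) (\<psi> z) \<le> 1 * dist y z"
    proof cases
      case 1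
      then show ?thesis using expand[OF 1] unfolding F\<psi> dist_real_def mult_1 by linarith
    next
      case 2
      then show ?thesis using expand[OF 2] unfolding F\<psi> dist_real_def mult_1 by linarith
    qed
  qed auto
  then have "continuous_on UNIV \<psi>" by (rule lipschitz_on_continuous_on)
  then have [measurable]: "\<psi> \<in> borel_measurable lborel"
    using borel_measurable_continuous_onI by auto
  define \<mu> where "\<mu> = distr lborel borel \<psi>"
  have \<mu>I: "emeasure \<mu> {a..b} = ennreal (F b - F a)" if "a \<le> b" for a b
  proof -
    have "\<psi> -` {a..b} = {F a..F b}"
    proof (rule set_eqI)
      fix y show "y \<in> \<psi> -` {a..b} \<longleftrightarrow> y \<in> {F a..F b}"
        using Fle[of a "\<psi> y"] Fle[of "\<psi> y" b] F\<psi>[of y] by simp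
    qed
    then show ?thesis unfolding \<mu>_def using that Fle by (subst emeasure_distr) auto
  qed
  have ac: "absolutely_continuous lborel \<mu>"
    unfolding absolutely_continuous_def
  proof
    fix N :: "real set" assume N: "N \<in> null_sets lborel"
    then have Nb[measurable]: "N \<in> sets borel" by auto
    have "negligible N" using N negligible_iff_null_sets null_sets_completionI by blast
    have "norm (F x - F y) \<le> (2 * L + 1) * norm (x - y)" for x y
    proof -
      have "F x - F y = (\<phi> x - \<phi> y) + (L + 1) * (x - y)" by (simp add: F_def algebra_simps)
      then have "\<bar>F x - F y\<bar> \<le> \<bar>\<phi> x - \<phi> y\<bar> + (L + 1) * \<bar>x - y\<bar>"
        using abs_triangle_ineq[of "\<phi> x - \<phi> y" "(L + 1) * (x - y)"] L0 by (simp add: abs_mult)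
      then show ?thesis using lipD[of x y] by (simp add: algebra_simps)
    qed
    then have "negligible (F ` N)"
      by (intro negligible_locally_Lipschitz_image[OF _ \<open>negligible N\<close>]) (simp, metis UNIV_I open_UNIV)
    moreover have "F ` N = \<psi> -` N"
    proof (rule set_eqI)
      have "\<psi> (F x) = x" for x
        using Fle[of "\<psi> (F x)" x] Fle[of x "\<psi> (F x)"] F\<psi>[of "F x"] by simp
      then show "y \<in> F ` N \<longleftrightarrow> y \<in> \<psi> -` N" for y
        by (metis F\<psi> image_iff vimage_eq)
    qed
    ultimately have "\<psi> -` N \<in> null_sets lebesgue" by (simp add: negligible_iff_null_sets)
    moreover have sets\<psi>: "\<psi> -` N \<in> sets lborel"
      using measurable_sets[OF \<open>\<psi> \<in> borel_measurable lborel\<close> Nb] by simp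
    ultimately have "emeasure lborel (\<psi> -` N) = 0"
      by (simp add: null_sets_completion_iff null_setsD1)
    then show "N \<in> null_sets \<mu>" unfolding \<mu>_def
      by (auto simp: null_sets_def emeasure_distr)
  qed
  obtain g where g[measurable]: "g \<in> borel_measurable lborel" and dens: "density lborel g = \<mu>"
    using sigma_finite_measure.Radon_Nikodym[OF sigma_finite_lborel ac] by (auto simp: \<mu>_def)
  have int: "(\<integral>\<^sup>+x. g x * indicator {a..b} x \<partial>lborel) = ennreal (F b - F a)" if "a \<le> b" for a b
  proof -
    have "(\<integral>\<^sup>+x. g x * indicator {a..b} x \<partial>lborel) = emeasure (density lborel g) {a..b}"
      by (subst emeasure_density) auto
    then show ?thesis using \<mu>I[OF that] dens by simp
  qed
  have "AE x in lborel. g x * indicator {-real n..real n} x \<noteq> \<infinity>" for n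
    by (rule nn_integral_PInf_AE) (auto simp: int)
  then have "AE x in lborel. \<forall>n. g x * indicator {-real n..real n} x \<noteq> \<infinity>"
    by (simp add: AE_all_countable)
  then have fin: "AE x in lborel. g x \<noteq> \<infinity>"
  proof (rule AE_mp, intro AE_I2 impI)
    fix x assume *: "\<forall>n. g x * indicator {-real n..real n} x \<noteq> \<infinity>"
    obtain n where "\<bar>x\<bar> \<le> real n" using real_arch_simple by blast
    then show "g x \<noteq> \<infinity>" using *[rule_format, of n] by (auto simp: indicator_def abs_le_iff)
  qed
  have "((\<lambda>x. enn2real (g x)) has_integral (F b - F a)) {a..b}" if "a \<le> b" for a b
  proof -
    have "((\<lambda>x. enn2real (g x) * indicator {a..b} x) has_integral (F b - F a)) UNIV"
    proof (rule nn_integral_has_integral)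
      have "(\<integral>\<^sup>+x. ennreal (enn2real (g x) * indicator {a..b} x) \<partial>lborel)
          = (\<integral>\<^sup>+x. g x * indicator {a..b} x \<partial>lborel)"
        by (rule nn_integral_cong_AE, use fin in \<open>eventually_elim\<close>)
           (auto simp: indicator_def less_top)
      then show "(\<integral>\<^sup>+x. ennreal (enn2real (g x) * indicator {a..b} x) \<partial>lborel) = ennreal (F b - F a)"
        using int[OF that] by simp
    qed (use that Fle in auto)
    moreover have "(\<lambda>x. enn2real (g x) * indicator {a..b} x) =
        (\<lambda>x. if x \<in> {a..b} then enn2real (g x) else 0)"
      by (auto simp: indicator_def)
    ultimately show ?thesis by (simp only: has_integral_restrict_UNIV)
  qed
  then have "((\<lambda>x. enn2real (g x) - (L + 1)) has_integral (F b - F a - (L + 1) * (b - a))) {a..b}"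
    if "a \<le> b" for a b
    using that has_integral_const_real[of "L + 1" a b]
    by (intro has_integral_diff) (auto simp: mult.commute)
  then show ?thesis
    by (intro that[of "\<lambda>x. enn2real (g x) - (L + 1)"]) (auto simp: F_def algebra_simps)
qed

text \<open>
  Sampling at the steps \<open>1 / (k + 1)\<close> keeps the set of divergence Borel for continuous \<open>F\<close>. For Lipschitz \<open>F\<close> the sequence
  determines the one-sided derivative (\<open>dquot_tendsto_imp_right_derivative\<close>).
\<close>

definition dquot :: "('a::real_normed_vector \<Rightarrow> real) \<Rightarrow> 'a \<Rightarrow> 'a \<Rightarrow> nat \<Rightarrow> real" where
  "dquot F v x k = real (Suc k) * (F (x + v /\<^sub>R real (Suc k)) - F x)"

text \<open>
  The difference quotients are averages of the density over \<open>[s, s + 1 / (k + 1)]\<close>, which converge at almost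
  every point by Lebesgue's differentiation theorem.
\<close>

lemma lipschitz_real_dquot_convergent_ae:
  fixes \<phi> :: "real \<Rightarrow> real"
  assumes "L-lipschitz_on UNIV \<phi>"
  shows "negligible {s. \<not> convergent (dquot \<phi> 1 s)}"
proof -
  obtain f where f: "\<And>a b. a \<le> b \<Longrightarrow> (f has_integral (\<phi> b - \<phi> a)) {a..b}"
    using lipschitz_indefinite_integral[OF assms] by blast
  have "f integrable_on cbox a b" for a b
    using f[of a b] by (cases "a \<le> b") (auto simp: integrable_on_def)
  note int = this
  obtain N where N: "negligible N"
    and lim: "\<And>x e. \<lbrakk>x \<notin> N; 0 < e\<rbrakk> \<Longrightarrow>
       \<exists>d>0. \<forall>h. 0 < h \<and> h < d \<longrightarrow>
         norm(integral (cbox x (x + h *\<^sub>R One)) f /\<^sub>R h ^ DIM(real) - f x) < e"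
    using integrable_ccontinuous_explicit[of f, OF int] by blast
  have "dquot \<phi> 1 s \<longlonglongrightarrow> f s" if "s \<notin> N" for s
  proof (rule LIMSEQ_I)
    fix e :: real assume "0 < e"
    with lim[OF that] obtain d where d: "d > 0"
      and *: "\<forall>h. 0 < h \<and> h < d \<longrightarrow> norm(integral (cbox s (s + h)) f / h - f s) < e"
      by (force simp: divide_inverse_commute)
    obtain n where n: "inverse (real (Suc n)) < d" using reals_Archimedean[OF d] by blast
    have "norm (dquot \<phi> 1 s k - f s) < e" if "k \<ge> n" for k
    proof -
      define i where "i = inverse (real (Suc k))"
      have "i \<le> inverse (real (Suc n))" using that by (simp add: i_def field_simps)
      then have i: "0 < i" "i < d" using n by (simp add: i_def, linarith)
      have "integral (cbox s (s + i)) f = \<phi> (s + i) - \<phi> s"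
        unfolding cbox_interval by (intro integral_unique f) (use i in auto)
      then have "norm ((\<phi> (s + i) - \<phi> s) / i - f s) < e"
        using *[rule_format, of i] i by auto
      moreover have "dquot \<phi> 1 s k = (\<phi> (s + i) - \<phi> s) / i"
        unfolding dquot_def i_def by (simp add: divide_inverse mult.commute)
      ultimately show ?thesis by simp
    qed
    then show "\<exists>no. \<forall>k\<ge>no. norm (dquot \<phi> 1 s k - f s) < e" by blast
  qed
  then have "{s. \<not> convergent (dquot \<phi> 1 s)} \<subseteq> N" by (auto simp: convergent_def)
  then show ?thesis using N negligible_subset by blast
qed

section \<open>Rademacher's theorem\<close>

text \<open>
  Fubini without choosing coordinates: Lebesgue measure is invariant under every translation by \<open>s *\<^sub>R v\<close>, so the
  measure of \<open>N\<close> equals the average over \<open>s \<in> [0, 1]\<close> of the measures of its translates. Exchanging the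
  integrals leaves, for each \<open>y\<close>, the measure of a subset of the null set in which the line through \<open>y\<close>
  meets \<open>N\<close>.
\<close>

lemma null_sets_if_null_on_lines:
  fixes N :: "'a::euclidean_space set"
  assumes N[measurable]: "N \<in> sets borel"
    and lines: "\<And>y. negligible {s::real. y + s *\<^sub>R v \<in> N}"
  shows "N \<in> null_sets lborel"
proof -
  have line0: "(\<integral>\<^sup>+s. indicator N (y + s *\<^sub>R v) * indicator {0..1} s \<partial>lborel) = 0" for y
  proof -
    have "{s. y + s *\<^sub>R v \<in> N} \<in> sets lborel" by simp
    moreover have "{s. y + s *\<^sub>R v \<in> N} \<in> null_sets lebesgue"
      using lines negligible_iff_null_sets by blast
    ultimately have "{s. y + s *\<^sub>R v \<in> N} \<in> null_sets lborel"
      by (simp add: null_sets_completion_iff)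
    then have "AE s in lborel. y + s *\<^sub>R v \<notin> N" by (auto dest: AE_not_in)
    then have "AE s in lborel. indicator N (y + s *\<^sub>R v) * indicator {0..1} s = (0::ennreal)"
      by eventually_elim auto
    then show ?thesis by (subst nn_integral_0_iff_AE) auto
  qed
  have shift: "(\<integral>\<^sup>+y. indicator N (y + s *\<^sub>R v) \<partial>lborel) = emeasure lborel N" for s
  proof -
    have "emeasure lborel N = (\<integral>\<^sup>+y. indicator N y \<partial>distr lborel borel ((+) (s *\<^sub>R v)))"
      by (simp add: lborel_distr_plus)
    also have "\<dots> = (\<integral>\<^sup>+y. indicator N (y + s *\<^sub>R v) \<partial>lborel)"
      by (subst nn_integral_distr) (auto simp: add.commute)
    finally show ?thesis by simp
  qed
  have "emeasure lborel N = (\<integral>\<^sup>+s. emeasure lborel N * indicator {0..1} s \<partial>(lborel :: real measure))"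
    by (simp add: nn_integral_cmult_indicator)
  also have "\<dots> = (\<integral>\<^sup>+s. (\<integral>\<^sup>+y. indicator N (y + s *\<^sub>R v) * indicator {0..1::real} s \<partial>lborel) \<partial>lborel)"
    by (simp add: nn_integral_multc shift)
  also have "\<dots> = (\<integral>\<^sup>+y. (\<integral>\<^sup>+s. indicator N (y + s *\<^sub>R v) * indicator {0..1::real} s \<partial>lborel) \<partial>lborel)"
    by (rule lborel_pair.Fubini') (measurable)
  also have "\<dots> = 0" by (simp add: line0)
  finally show ?thesis by (auto simp: null_sets_def)
qed

lemma lipschitz_dquot_bound:
  fixes F :: "'a::real_normed_vector \<Rightarrow> real"
  assumes lip: "L-lipschitz_on UNIV F"
  shows "\<bar>dquot F v x k\<bar> \<le> L * norm v"
proof -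
  define n where "n = real (Suc k)"
  have n: "n > 0" by (simp add: n_def)
  have "\<bar>dquot F v x k\<bar> = n * dist (F (x + v /\<^sub>R n)) (F x)"
    using n by (simp only: dquot_def n_def[symmetric] abs_mult dist_real_def)
  also have "\<dots> \<le> n * (L * dist (x + v /\<^sub>R n) x)"
    using n by (intro mult_left_mono lipschitz_onD[OF lip]) auto
  also have "dist (x + v /\<^sub>R n) x = norm v / n"
    using n by (simp add: dist_norm divide_inverse mult.commute)
  also have "n * (L * (norm v / n)) = L * norm v" using n by simp
  finally show ?thesis .
qed

lemma borel_measurable_dquot:
  fixes F :: "'a::euclidean_space \<Rightarrow> real"
  assumes "continuous_on UNIV F"
  shows "(\<lambda>x. dquot F v x k) \<in> borel_measurable borel"
  unfolding dquot_def
  by (intro borel_measurable_continuous_onI continuous_intros continuous_on_compose2[OF assms]) auto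

lemma lipschitz_dquot_convergent_ae:
  fixes F :: "'a::euclidean_space \<Rightarrow> real"
  assumes lip: "L-lipschitz_on UNIV F"
  shows "AE x in lborel. convergent (dquot F v x)"
proof -
  have cont: "continuous_on UNIV F" by (rule lipschitz_on_continuous_on[OF lip])
  define N where "N = {x. \<not> convergent (dquot F v x)}"
  note [measurable] = borel_measurable_dquot[OF cont]
  have "{x \<in> space borel. Cauchy (\<lambda>k. dquot F v x k)} \<in> sets borel" by measurable
  then have "space borel - {x \<in> space borel. Cauchy (\<lambda>k. dquot F v x k)} \<in> sets borel" by blast
  moreover have "N = space borel - {x \<in> space borel. Cauchy (\<lambda>k. dquot F v x k)}"
    by (auto simp: N_def Cauchy_convergent_iff)
  ultimately have "N \<in> sets borel" by simp
  moreover have "negligible {s::real. y + s *\<^sub>R v \<in> N}" for y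
  proof -
    define \<phi> where "\<phi> = (\<lambda>s::real. F (y + s *\<^sub>R v))"
    have "(L * norm v)-lipschitz_on UNIV \<phi>"
    proof (rule lipschitz_onI)
      fix s t :: real
      have "dist (\<phi> s) (\<phi> t) \<le> L * dist (y + s *\<^sub>R v) (y + t *\<^sub>R v)"
        unfolding \<phi>_def by (rule lipschitz_onD[OF lip]) auto
      also have "\<dots> = L * norm v * dist s t"
        by (simp add: dist_norm flip: scaleR_diff_left)
      finally show "dist (\<phi> s) (\<phi> t) \<le> L * norm v * dist s t" .
    qed (use lipschitz_on_nonneg[OF lip] in auto)
    moreover have "dquot F v (y + s *\<^sub>R v) = dquot \<phi> 1 s" for s
      by (auto simp: dquot_def \<phi>_def algebra_simps)
    ultimately show ?thesis
      using lipschitz_real_dquot_convergent_ae by (simp add: N_def)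
  qed
  ultimately have "N \<in> null_sets lborel" by (rule null_sets_if_null_on_lines)
  then show ?thesis by (rule AE_I') (auto simp: N_def)
qed

definition dirderiv :: "('a::real_normed_vector \<Rightarrow> real) \<Rightarrow> 'a \<Rightarrow> 'a \<Rightarrow> real" where
  "dirderiv F v x = lim (dquot F v x)"

text \<open>
  Almost every value of \<open>h\<close> is a limit of averages over boxes.
\<close>

lemma ae_eq_0_if_integral_cbox_0:
  fixes h :: "'a::euclidean_space \<Rightarrow> real"
  assumes "\<And>a b. (h has_integral 0) (cbox a b)"
  shows "negligible {x. h x \<noteq> 0}"
proof -
  have int: "h integrable_on cbox a b" for a b using assms by blast
  obtain N where N: "negligible N"
    and lim: "\<And>x e. \<lbrakk>x \<notin> N; 0 < e\<rbrakk> \<Longrightarrow>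
       \<exists>d>0. \<forall>r. 0 < r \<and> r < d \<longrightarrow>
         norm(integral (cbox x (x + r *\<^sub>R One)) h /\<^sub>R r ^ DIM('a) - h x) < e"
    using integrable_ccontinuous_explicit[of h, OF int] by blast
  have "h x = 0" if x: "x \<notin> N" for x
  proof (rule ccontr)
    assume "h x \<noteq> 0"
    then obtain d where "d > 0"
      "\<And>r. 0 < r \<Longrightarrow> r < d \<Longrightarrow> norm(integral (cbox x (x + r *\<^sub>R One)) h /\<^sub>R r ^ DIM('a) - h x) < norm (h x)"
      using lim[OF x, of "norm (h x)"] unfolding zero_less_norm_iff by blast
    from this(1) this(2)[of "d / 2"] show False
      using integral_unique[OF assms] by simp
  qed
  then have "{x. h x \<noteq> 0} \<subseteq> N" by auto
  then show ?thesis using N negligible_subset by blast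
qed

text \<open>
  The difference quotient along \<open>u + v\<close> at \<open>x\<close> is the one along \<open>v\<close> at \<open>x\<close> plus the one along \<open>u\<close> at the shifted
  point \<open>x + v / (k + 1)\<close>. Quotients at moving points need not converge pointwise, but under an integral over a
  box the shift can be moved to the indicator function of the box, and dominated convergence applies. So both sides have the same integral
  over every box.
\<close>

lemma lipschitz_dirderiv_add_ae:
  fixes F :: "'a::euclidean_space \<Rightarrow> real"
  assumes lip: "L-lipschitz_on UNIV F"
  shows "AE x in lborel. dirderiv F (u + v) x = dirderiv F u x + dirderiv F v x"
proof -
  have L0: "0 \<le> L" using lip by (rule lipschitz_on_nonneg)
  have cont: "continuous_on UNIV F" by (rule lipschitz_on_continuous_on[OF lip])
  note [measurable] = borel_measurable_dquot[OF cont]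
  have dmeas[measurable]: "(\<lambda>x. dirderiv F v x) \<in> borel_measurable borel" for v
    unfolding dirderiv_def by measurable
  have conv: "AE x in lborel. dquot F v x \<longlonglongrightarrow> dirderiv F v x" for v
    using lipschitz_dquot_convergent_ae[OF lip, of v]
    by eventually_elim (simp add: dirderiv_def convergent_LIMSEQ_iff)
  define h where "h = (\<lambda>x. dirderiv F (u + v) x - dirderiv F u x - dirderiv F v x)"
  have [measurable]: "h \<in> borel_measurable borel" unfolding h_def by measurable
  have "(h has_integral 0) (cbox a b)" for a b
  proof -
    define Q where "Q = cbox a b"
    have [measurable]: "Q \<in> sets borel" by (simp add: Q_def)
    define w where "w = (\<lambda>k. v /\<^sub>R real (Suc k))"
    have w0: "w \<longlonglongrightarrow> 0"
    proof -
      have "(\<lambda>k. inverse (real (Suc k)) *\<^sub>R v) \<longlonglongrightarrow> 0 *\<^sub>R v"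
        by (intro tendsto_intros LIMSEQ_inverse_real_of_nat)
      then show ?thesis by (simp add: w_def)
    qed
    have wn: "norm (w k) \<le> norm v" for k
      by (simp add: w_def divide_simps mult_le_cancel_left1)
    have "bounded Q" by (simp add: Q_def)
    then obtain R where R: "\<And>x. x \<in> Q \<Longrightarrow> norm x \<le> R" by (auto simp: bounded_iff)
    define B where "B = (cball 0 (R + norm v) :: 'a set)"
    have [measurable]: "B \<in> sets borel" by (simp add: B_def)
    have Bfin: "emeasure lborel B < \<infinity>" unfolding B_def by (intro emeasure_bounded_finite) auto
    have QB: "indicator Q (x - w k) \<noteq> (0::real) \<Longrightarrow> x \<in> B" for x k
    proof -
      assume "indicator Q (x - w k) \<noteq> (0::real)"
      then have "norm (x - w k) \<le> R" using R by (auto simp: indicator_def split: if_splits)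
      then show "x \<in> B" using wn[of k] norm_triangle_ineq[of "x - w k" "w k"] by (simp add: B_def)
    qed
    have QB': "indicator Q x \<noteq> (0::real) \<Longrightarrow> x \<in> B" for x
      using R[of x] by (auto simp: indicator_def B_def add_increasing2 split: if_splits)
    have fr: "AE x in lborel. x \<notin> frontier Q"
    proof -
      have "negligible (frontier Q)" unfolding Q_def by (intro negligible_convex_frontier convex_box)
      then have "frontier Q \<in> null_sets lebesgue" by (simp add: negligible_iff_null_sets)
      then have "frontier Q \<in> null_sets lborel" 
        using null_sets_completion_iff[of "frontier Q" lborel] borel_closed[OF frontier_closed[of Q]] by simp
      then show ?thesis by (rule AE_not_in)
    qed
    (* The translated indicators converge off the frontier of the box, which is a null set. *)
    have shifted: "(\<lambda>k. \<integral>x. indicator Q (x - w k) * dquot F u x k \<partial>lborel)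
        \<longlonglongrightarrow> (\<integral>x. indicator Q x * dirderiv F u x \<partial>lborel)"
    proof (rule integral_dominated_convergence[where w = "\<lambda>x. L * norm u * indicator B x"])
      show "integrable lborel (\<lambda>x. L * norm u * indicat_real B x)" using Bfin by simp
      show "AE x in lborel. (\<lambda>k. indicator Q (x - w k) * dquot F u x k)
          \<longlonglongrightarrow> indicator Q x * dirderiv F u x"
        using conv[of u] fr
      proof eventually_elim
        case (elim x)
        have "(\<lambda>k. indicat_real Q (x - w k)) \<longlonglongrightarrow> indicator Q (x - 0)"
          by (rule tendsto_compose[of "indicat_real Q"], rule isContD, subst isCont_indicator)
             (use elim w0 in \<open>auto intro!: tendsto_eq_intros\<close>)
        then show ?case using elim(1) by (intro tendsto_mult) auto
      qed
      show "AE x in lborel. norm (indicator Q (x - w k) * dquot F u x k) \<le> L * norm u * indicator B x" for k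
      proof (rule AE_I2)
        fix x show "norm (indicator Q (x - w k) * dquot F u x k) \<le> L * norm u * indicator B x"
          using QB[of x k] lipschitz_dquot_bound[OF lip, of u x k] L0
          by (cases "x - w k \<in> Q") (auto simp: indicator_def abs_mult split: if_splits)
      qed
    qed measurable
    have plain: "(\<lambda>k. \<integral>x. indicator Q x * dquot F u x k \<partial>lborel)
        \<longlonglongrightarrow> (\<integral>x. indicator Q x * dirderiv F u x \<partial>lborel)"
      and int_dirderiv: "integrable lborel (\<lambda>x. indicator Q x * dirderiv F u x)"
      and int_dquot: "integrable lborel (\<lambda>x. indicator Q x * dquot F u x k)" for u k
    proof -
      have bd: "AE x in lborel. norm (indicator Q x * dquot F u x k) \<le> L * norm u * indicator B x" for k
      proof (rule AE_I2)
        fix x show "norm (indicator Q x * dquot F u x k) \<le> L * norm u * indicator B x"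
          using QB'[of x] lipschitz_dquot_bound[OF lip, of u x k] L0
          by (cases "x \<in> Q") (auto simp: indicator_def abs_mult split: if_splits)
      qed
      have bi: "integrable lborel (\<lambda>x. L * norm u * indicat_real B x)" using Bfin by simp
      have li: "AE x in lborel. (\<lambda>k. indicat_real Q x * dquot F u x k) \<longlonglongrightarrow> indicator Q x * dirderiv F u x"
        using conv[of u] by eventually_elim (intro tendsto_intros)
      show "(\<lambda>k. \<integral>x. indicator Q x * dquot F u x k \<partial>lborel)
          \<longlonglongrightarrow> (\<integral>x. indicator Q x * dirderiv F u x \<partial>lborel)"
        by (rule integral_dominated_convergence[OF _ _ bi li bd]) measurable
      show "integrable lborel (\<lambda>x. indicator Q x * dirderiv F u x)"
        by (rule integrable_dominated_convergence[OF _ _ bi li bd]) measurable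
      show "integrable lborel (\<lambda>x. indicator Q x * dquot F u x k)"
        by (rule Bochner_Integration.integrable_bound[OF bi]) (use bd[of k] L0 in auto)
    qed
    have split: "(\<integral>x. indicator Q x * dquot F (u + v) x k \<partial>lborel) =
       (\<integral>x. indicator Q (x - w k) * dquot F u x k \<partial>lborel) + (\<integral>x. indicator Q x * dquot F v x k \<partial>lborel)"
      for k
    proof -
      have dq: "dquot F (u + v) x k = dquot F u (w k + x) k + dquot F v x k" for x
        by (simp add: dquot_def w_def algebra_simps)
      have "(\<integral>x. indicator Q (x - w k) * dquot F u x k \<partial>lborel) =
        (\<integral>x. indicator Q (x - w k) * dquot F u x k \<partial>distr lborel borel ((+) (w k)))"
        by (simp add: lborel_distr_plus)
      also have "\<dots> = (\<integral>x. indicator Q x * dquot F u (w k + x) k \<partial>lborel)"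
        by (subst integral_distr) auto
      also have "\<dots> = (\<integral>x. indicator Q x * dquot F (u + v) x k - indicator Q x * dquot F v x k \<partial>lborel)"
        by (simp add: dq algebra_simps)
      also have "\<dots> = (\<integral>x. indicator Q x * dquot F (u + v) x k \<partial>lborel) - (\<integral>x. indicator Q x * dquot F v x k \<partial>lborel)"
        by (intro Bochner_Integration.integral_diff int_dquot)
      finally show ?thesis by simp
    qed
    have "(\<integral>x. indicator Q x * dirderiv F (u + v) x \<partial>lborel) =
       (\<integral>x. indicator Q x * dirderiv F u x \<partial>lborel) + (\<integral>x. indicator Q x * dirderiv F v x \<partial>lborel)"
      by (rule LIMSEQ_unique[OF plain[of "u + v"]]) (unfold split, intro tendsto_add shifted plain)
    then have "has_bochner_integral lborel (\<lambda>x. indicator Q x * h x) 0"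
      unfolding has_bochner_integral_iff h_def
      by (simp add: right_diff_distrib int_dirderiv Bochner_Integration.integral_diff)
    then have "((\<lambda>x. indicator Q x * h x) has_integral 0) UNIV"
      using has_integral_integral_lborel has_bochner_integral_iff by metis
    moreover have "(\<lambda>x. indicator Q x * h x) = (\<lambda>x. if x \<in> Q then h x else 0)"
      by (auto simp: indicator_def)
    ultimately show ?thesis unfolding Q_def[symmetric] by (simp add: has_integral_restrict_UNIV)
  qed
  then have "negligible {x. h x \<noteq> 0}" by (rule ae_eq_0_if_integral_cbox_0)
  moreover have "{x. h x \<noteq> 0} \<in> sets lborel" by simp
  ultimately have "{x. h x \<noteq> 0} \<in> null_sets lborel"
    by (simp add: negligible_iff_null_sets null_sets_completion_iff)
  then have "AE x in lborel. h x = 0" by (auto dest: AE_not_in)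
  then show ?thesis by eventually_elim (simp add: h_def)
qed

text \<open>
  A step \<open>t\<close> lies between two consecutive sample steps, which differ by at most \<open>t * s\<close>, where \<open>s\<close> is the
  larger one. By the Lipschitz condition, replacing \<open>t\<close> by \<open>s\<close> costs only \<open>o(t)\<close>.
\<close>

lemma dquot_tendsto_imp_right_derivative:
  fixes F :: "'a::real_normed_vector \<Rightarrow> real"
  assumes lip: "L-lipschitz_on UNIV F" and lim: "dquot F v x \<longlonglongrightarrow> d" and e: "0 < e"
  shows "\<exists>\<delta>>0. \<forall>t. 0 < t \<and> t < \<delta> \<longrightarrow> \<bar>F (x + t *\<^sub>R v) - F x - t * d\<bar> \<le> e * t"
proof -
  define C where "C = L * norm v + \<bar>d\<bar>"
  have C0: "0 \<le> C" using lipschitz_on_nonneg[OF lip] by (simp add: C_def)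
  have "e / 4 > 0" using e by simp
  from LIMSEQ_D[OF lim this] obtain K1
    where K1: "\<And>k. k \<ge> K1 \<Longrightarrow> \<bar>dquot F v x k - d\<bar> < e / 4"
    by auto
  obtain K2 where K2: "C / (e / 2) \<le> real K2" using real_arch_simple by blast
  define K where "K = max K1 K2"
  define \<delta> where "\<delta> = 1 / (real K + 2)"
  have "\<bar>F (x + t *\<^sub>R v) - F x - t * d\<bar> \<le> e * t" if t: "0 < t" "t < \<delta>" for t
  proof -
    have big: "real K + 2 < 1 / t" using t by (simp add: \<delta>_def field_simps)
    define m where "m = nat \<lfloor>1 / t\<rfloor>"
    have m: "real m \<le> 1 / t" "1 / t < real m + 1" using t unfolding m_def by (auto simp: of_nat_nat)
    then have "m \<ge> K + 2" using big by linarith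
    then obtain k where k: "m = Suc k" "k \<ge> K" by (metis add_2_eq_Suc' Suc_le_D Suc_le_mono le_Suc_eq)
    define s where "s = 1 / real m"
    have m0: "real m > 0" using k by simp
    have ts: "t \<le> s" using m(1) t m0 unfolding s_def by (simp add: field_simps)
    have "s - t \<le> t * s"
    proof -
      have "s * (real m + 1) * t \<ge> s * 1" using m(2) t m0
        by (intro order.trans[OF _ eq_refl[OF mult.assoc[symmetric]]] mult_left_mono) (auto simp: s_def field_simps)
      then have "s \<le> t + s * t" using m0 by (simp add: s_def field_simps)
      then show ?thesis by (simp add: mult.commute)
    qed
    moreover have "s \<le> 1" using k by (simp add: s_def)
    ultimately have s2: "s \<le> 2 * t" using mult_left_le[of s t] t by linarith
    have Fs: "F (x + s *\<^sub>R v) - F x = s * dquot F v x k"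
      using m0 by (simp add: dquot_def s_def k divide_inverse_commute del: of_nat_Suc)
    have "\<bar>F (x + s *\<^sub>R v) - F x - s * d\<bar> = s * \<bar>dquot F v x k - d\<bar>"
      unfolding Fs right_diff_distrib[symmetric] abs_mult using m0 by (simp add: s_def)
    also have "\<dots> \<le> (2 * t) * (e / 4)"
      using K1[of k] k s2 m0 t by (intro mult_mono) (auto simp: K_def s_def)
    finally have 1: "\<bar>F (x + s *\<^sub>R v) - F x - s * d\<bar> \<le> e * t / 2" by simp
    have "\<bar>F (x + t *\<^sub>R v) - F (x + s *\<^sub>R v)\<bar> \<le> L * norm ((t - s) *\<^sub>R v)"
      using lipschitz_onD[OF lip, of "x + t *\<^sub>R v" "x + s *\<^sub>R v"]
      by (simp add: dist_norm scaleR_diff_left)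
    also have "\<dots> = (s - t) * (L * norm v)" using ts by simp
    finally have 2: "\<bar>F (x + t *\<^sub>R v) - F (x + s *\<^sub>R v)\<bar> \<le> (s - t) * (L * norm v)" .
    have 3: "\<bar>s * d - t * d\<bar> = (s - t) * \<bar>d\<bar>"
      using ts by (simp add: abs_mult flip: left_diff_distrib)
    have "C / (e / 2) \<le> real m" using K2 k by (auto simp: K_def)
    then have "C * s \<le> e / 2" using e m0 by (simp add: s_def field_simps)
    have "(s - t) * C \<le> (t * s) * C" using \<open>s - t \<le> t * s\<close> C0 by (rule mult_right_mono)
    also have "\<dots> \<le> t * (e / 2)" using \<open>C * s \<le> e / 2\<close> t by (simp add: mult.commute mult.left_commute)
    finally have "(s - t) * (L * norm v) + (s - t) * \<bar>d\<bar> \<le> e * t / 2"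
      by (simp add: C_def algebra_simps)
    with 1 2 3 show ?thesis by linarith
  qed
  moreover have "\<delta> > 0" by (simp add: \<delta>_def)
  ultimately show ?thesis by blast
qed

lemma lipschitz_dirderiv_scale_pos:
  fixes F :: "'a::real_normed_vector \<Rightarrow> real"
  assumes lip: "L-lipschitz_on UNIV F" and c: "0 < c"
    and "convergent (dquot F v x)" "convergent (dquot F (c *\<^sub>R v) x)"
  shows "dirderiv F (c *\<^sub>R v) x = c * dirderiv F v x"
proof -
  let ?d1 = "dirderiv F (c *\<^sub>R v) x" and ?d2 = "dirderiv F v x"
  have "\<bar>?d1 - c * ?d2\<bar> \<le> 0 + e" if "e > 0" for e
  proof -
    define e' where "e' = e / (1 + c)"
    have e': "e' > 0" "e' * (1 + c) = e" using that c by (auto simp: e'_def)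
    obtain \<delta>1 where 1: "\<delta>1 > 0"
      "\<And>t. 0 < t \<Longrightarrow> t < \<delta>1 \<Longrightarrow> \<bar>F (x + t *\<^sub>R c *\<^sub>R v) - F x - t * ?d1\<bar> \<le> e' * t"
      using dquot_tendsto_imp_right_derivative[OF lip _ e'(1), of "c *\<^sub>R v" x ?d1] assms(4)
      by (auto simp: dirderiv_def convergent_LIMSEQ_iff)
    obtain \<delta>2 where 2: "\<delta>2 > 0"
      "\<And>t. 0 < t \<Longrightarrow> t < \<delta>2 \<Longrightarrow> \<bar>F (x + t *\<^sub>R v) - F x - t * ?d2\<bar> \<le> e' * t"
      using dquot_tendsto_imp_right_derivative[OF lip _ e'(1), of v x ?d2] assms(3)
      by (auto simp: dirderiv_def convergent_LIMSEQ_iff)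
    define t where "t = min \<delta>1 (\<delta>2 / c) / 2"
    have t: "0 < t" "t < \<delta>1" "t * c < \<delta>2"
      using 1 2 c by (auto simp: t_def min_def field_simps)
    have "\<bar>F (x + t *\<^sub>R c *\<^sub>R v) - F x - t * ?d1\<bar> \<le> e' * t"
      "\<bar>F (x + t *\<^sub>R c *\<^sub>R v) - F x - t * c * ?d2\<bar> \<le> e' * (t * c)"
      using 1(2)[OF t(1,2)] 2(2)[OF _ t(3)] t c by auto
    then have "\<bar>t * ?d1 - t * c * ?d2\<bar> \<le> e' * t + e' * (t * c)" by linarith
    also have "\<dots> = t * e" by (simp add: algebra_simps flip: e'(2))
    also have "\<bar>t * ?d1 - t * c * ?d2\<bar> = t * \<bar>?d1 - c * ?d2\<bar>"
      using t(1) by (simp add: abs_mult mult.assoc flip: right_diff_distrib)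
    finally show ?thesis using t(1) by simp
  qed
  then have "\<bar>?d1 - c * ?d2\<bar> \<le> 0" by (rule field_le_epsilon)
  then show ?thesis by simp
qed

lemma dirderiv_0: "dirderiv F 0 x = 0"
proof -
  have "dquot F 0 x = (\<lambda>_. 0)" by (auto simp: dquot_def)
  then show ?thesis by (simp add: dirderiv_def)
qed

text \<open>
  Additivity, applied to \<open>v\<close> and \<open>- v\<close>, is what makes the one-sided derivative odd almost everywhere.
\<close>

lemma lipschitz_dirderiv_scale_ae:
  fixes F :: "'a::euclidean_space \<Rightarrow> real"
  assumes lip: "L-lipschitz_on UNIV F"
  shows "AE x in lborel. dirderiv F (c *\<^sub>R v) x = c * dirderiv F v x"
proof -
  note conv = lipschitz_dquot_convergent_ae[OF lip]
  consider "c = 0" | "c > 0" | "c < 0" by linarith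
  then show ?thesis
  proof cases
    case 1
    then show ?thesis by (simp add: dirderiv_0)
  next
    case 2
    show ?thesis using conv[of v] conv[of "c *\<^sub>R v"]
      by eventually_elim (rule lipschitz_dirderiv_scale_pos[OF lip 2])
  next
    case 3
    have "AE x in lborel. dirderiv F (- v) x = - dirderiv F v x"
      using lipschitz_dirderiv_add_ae[OF lip, of v "- v"]
      by eventually_elim (simp add: dirderiv_0)
    then show ?thesis using conv[of "- v"] conv[of "(- c) *\<^sub>R - v"]
    proof eventually_elim
      case (elim x)
      then show ?case
        using lipschitz_dirderiv_scale_pos[OF lip, of "- c" "- v" x] 3 by simp
    qed
  qed
qed

lemma lipschitz_dirderiv_linear_ae:
  fixes F :: "'a::euclidean_space \<Rightarrow> real"
  assumes lip: "L-lipschitz_on UNIV F"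
  shows "AE x in lborel. dirderiv F v x = (\<Sum>b\<in>Basis. (v \<bullet> b) * dirderiv F b x)"
proof -
  have "AE x in lborel. dirderiv F (\<Sum>b\<in>B. (v \<bullet> b) *\<^sub>R b) x = (\<Sum>b\<in>B. (v \<bullet> b) * dirderiv F b x)"
    if "finite B" for B
    using that
  proof (induction B)
    case empty
    then show ?case by (simp add: dirderiv_0)
  next
    case (insert b B)
    show ?case
      using insert.IH lipschitz_dirderiv_scale_ae[OF lip, of "v \<bullet> b" b]
        lipschitz_dirderiv_add_ae[OF lip, of "(v \<bullet> b) *\<^sub>R b" "\<Sum>b\<in>B. (v \<bullet> b) *\<^sub>R b"]
      by eventually_elim (simp add: insert.hyps)
  qed
  from this[OF finite_Basis] show ?thesis by (simp add: euclidean_representation)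
qed

text \<open>
  Finitely many directions of \<open>D\<close> form an \<open>\<eta>\<close>-net of the unit sphere. In these directions the remainder is small
  uniformly, and passing from a unit vector to the nearest one of them changes \<open>F\<close> and \<open>A\<close> by at most
  \<open>(L + C) * \<eta>\<close> times the step.
\<close>

lemma lipschitz_has_derivative_if_dense_directions:
  fixes F :: "'a::euclidean_space \<Rightarrow> real"
  assumes lip: "L-lipschitz_on UNIV F" and A: "bounded_linear A"
    and dense: "\<And>X. open X \<Longrightarrow> X \<noteq> {} \<Longrightarrow> \<exists>v\<in>D. v \<in> X"
    and dir: "\<And>v. v \<in> D \<Longrightarrow> dquot F v x \<longlonglongrightarrow> A v"
  shows "(F has_derivative A) (at x)"
  unfolding has_derivative_at_alt
proof (intro conjI A allI impI)
  fix e :: real assume e: "0 < e"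
  have L0: "0 \<le> L" using lip by (rule lipschitz_on_nonneg)
  obtain C where C: "C > 0" "\<And>h. \<bar>A h\<bar> \<le> norm h * C"
    using bounded_linear.pos_bounded[OF A] by auto
  define \<eta> where "\<eta> = e / 2 / (L + C)"
  have \<eta>: "\<eta> > 0" "(L + C) * \<eta> = e / 2" 
  proof -
    have "L + C > 0" using L0 C(1) by simp
    then show "\<eta> > 0" using e by (simp add: \<eta>_def)
    show "(L + C) * \<eta> = e / 2" unfolding \<eta>_def
      by (subst times_divide_eq_right, rule nonzero_mult_div_cancel_left) (use \<open>L + C > 0\<close> in simp)
  qed
  have "\<exists>v\<in>D. w \<in> ball v \<eta>" for w
    using dense[of "ball w \<eta>"] \<eta> by (auto simp: dist_commute)
  then have "sphere (0::'a) 1 \<subseteq> (\<Union>v\<in>D. ball v \<eta>)" by auto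
  then obtain W where W: "W \<subseteq> D" "finite W" and cover: "sphere (0::'a) 1 \<subseteq> (\<Union>v\<in>W. ball v \<eta>)"
    using compactE_image[OF compact_sphere[of 0 1], of D "\<lambda>v. ball v \<eta>"] by auto
  have "\<forall>v\<in>W. \<exists>\<delta>>0. \<forall>t. 0 < t \<and> t < \<delta> \<longrightarrow> \<bar>F (x + t *\<^sub>R v) - F x - t * A v\<bar> \<le> (e / 2) * t"
    using W dir e by (intro ballI dquot_tendsto_imp_right_derivative[OF lip]) auto
  then obtain \<delta> where \<delta>: "\<And>v. v \<in> W \<Longrightarrow> \<delta> v > (0::real)"
    "\<And>v t. v \<in> W \<Longrightarrow> 0 < t \<Longrightarrow> t < \<delta> v \<Longrightarrow> \<bar>F (x + t *\<^sub>R v) - F x - t * A v\<bar> \<le> (e / 2) * t"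
    by metis
  define d where "d = Min (insert 1 (\<delta> ` W))"
  have d: "d > 0" "\<And>v. v \<in> W \<Longrightarrow> d \<le> \<delta> v" using W \<delta> by (auto simp: d_def)
  have "norm (F y - F x - A (y - x)) \<le> e * norm (y - x)" if y: "norm (y - x) < d" for y
  proof (cases "y = x")
    case True
    then show ?thesis using linear_0[OF bounded_linear.linear[OF A]] by simp
  next
    case False
    define t where "t = norm (y - x)"
    have t: "0 < t" "t < d" using False y by (auto simp: t_def)
    define w where "w = (y - x) /\<^sub>R t"
    have yw: "y = x + t *\<^sub>R w" "y - x = t *\<^sub>R w" using t by (auto simp: w_def)
    have "norm w = 1" using t by (simp add: w_def t_def)
    then obtain v where v: "v \<in> W" "norm (w - v) < \<eta>"
      using cover by (force simp: dist_norm norm_minus_commute)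
    have "\<bar>F (x + t *\<^sub>R v) - F x - t * A v\<bar> \<le> (e / 2) * t" using \<delta>(2)[OF v(1)] t d(2)[OF v(1)] by simp
    moreover have "\<bar>F y - F (x + t *\<^sub>R v)\<bar> \<le> L * (t * \<eta>)"
    proof -
      have "\<bar>F y - F (x + t *\<^sub>R v)\<bar> \<le> L * norm (t *\<^sub>R (w - v))"
        using lipschitz_onD[OF lip, of y "x + t *\<^sub>R v"] yw(1) by (simp add: dist_norm scaleR_diff_right)
      also have "\<dots> \<le> L * (t * \<eta>)" using v(2) L0 t by (intro mult_left_mono) auto
      finally show ?thesis .
    qed
    moreover have "\<bar>t * A v - A (y - x)\<bar> \<le> C * (t * \<eta>)"
    proof -
      have "t * A v - A (y - x) = A (t *\<^sub>R (v - w))"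
        unfolding yw(2) scaleR_diff_right by (simp add: linear_simps[OF A])
      also have "\<bar>\<dots>\<bar> \<le> norm (t *\<^sub>R (v - w)) * C" by (rule C)
      also have "\<dots> \<le> (t * \<eta>) * C" using v(2) C(1) t
        by (intro mult_right_mono) (auto simp: norm_minus_commute)
      finally show ?thesis by (simp add: mult.commute)
    qed
    moreover have "L * (t * \<eta>) + C * (t * \<eta>) = (e / 2) * t"
      unfolding \<eta>(2)[symmetric] by (simp add: algebra_simps)
    ultimately show ?thesis unfolding t_def[symmetric] real_norm_def by linarith
  qed
  then show "\<exists>d>0. \<forall>y. norm (y - x) < d \<longrightarrow> norm (F y - F x - A (y - x)) \<le> e * norm (y - x)"
    using d(1) by blast
qed

theorem Rademacher:
  fixes F :: "'a::euclidean_space \<Rightarrow> real"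
  assumes lip: "L-lipschitz_on UNIV F"
  shows "AE x in lebesgue. F differentiable (at x)"
proof -
  obtain D :: "'a set" where D: "countable D"
    and dense: "\<And>X. open X \<Longrightarrow> X \<noteq> {} \<Longrightarrow> \<exists>v\<in>D. v \<in> X"
    using countable_dense_setE by metis
  have "AE x in lborel. dquot F v x \<longlonglongrightarrow> (\<Sum>b\<in>Basis. (v \<bullet> b) * dirderiv F b x)" for v
    using lipschitz_dquot_convergent_ae[OF lip, of v] lipschitz_dirderiv_linear_ae[OF lip, of v]
    by eventually_elim (simp add: dirderiv_def convergent_LIMSEQ_iff)
  then have "AE x in lborel. \<forall>v\<in>D. dquot F v x \<longlonglongrightarrow> (\<Sum>b\<in>Basis. (v \<bullet> b) * dirderiv F b x)"
    by (subst AE_ball_countable[OF D]) blast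
  then have "AE x in lborel. F differentiable (at x)"
  proof eventually_elim
    case (elim x)
    have "bounded_linear (\<lambda>v. \<Sum>b\<in>Basis. (v \<bullet> b) * dirderiv F b x)"
      by (intro bounded_linear_sum bounded_linear_mult_const bounded_linear_inner_left)
    then have "(F has_derivative (\<lambda>v. \<Sum>b\<in>Basis. (v \<bullet> b) * dirderiv F b x)) (at x)"
      by (rule lipschitz_has_derivative_if_dense_directions[OF lip _ dense]) (use elim in auto)
    then show ?case by (auto simp: differentiable_def)
  qed
  then show ?thesis by (rule AE_completion)
qed

text \<open>
  McShane's extension: the largest \<open>L\<close>-Lipschitz function below all the cones \<open>g s + L * dist x s\<close>.
\<close>

lemma lipschitz_extension_real:
  fixes g :: "'a::metric_space \<Rightarrow> real"
  assumes lip: "L-lipschitz_on S g"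
  obtains F where "L-lipschitz_on UNIV F" "\<And>x. x \<in> S \<Longrightarrow> F x = g x"
proof (cases "S = {}")
  case True
  show ?thesis
    by (rule that[of "\<lambda>_. 0"]) (use True lipschitz_on_nonneg[OF lip] in \<open>auto intro: lipschitz_onI\<close>)
next
  case False
  have L0: "0 \<le> L" using lip by (rule lipschitz_on_nonneg)
  define F where "F = (\<lambda>x. INF s\<in>S. g s + L * dist x s)"
  have lipD: "g s - g s' \<le> L * dist s s'" if "s \<in> S" "s' \<in> S" for s s'
    using lipschitz_onD[OF lip that] by (simp add: dist_real_def)
  have bdd: "bdd_below ((\<lambda>s. g s + L * dist x s) ` S)" for x
  proof -
    obtain s0 where s0: "s0 \<in> S" using False by blast
    have "g s0 - L * dist x s0 \<le> g s + L * dist x s" if "s \<in> S" for s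
    proof -
      have "L * dist s0 s \<le> L * (dist x s0 + dist x s)"
        using L0 by (intro mult_left_mono) (auto simp: dist_triangle3)
      then show ?thesis using lipD[OF s0 that] by (simp add: algebra_simps)
    qed
    then show ?thesis by (intro bdd_belowI2)
  qed
  have le: "F x \<le> F y + L * dist x y" for x y
  proof -
    have "F x - L * dist x y \<le> g s + L * dist y s" if "s \<in> S" for s
    proof -
      have "F x \<le> g s + L * dist x s" unfolding F_def by (rule cINF_lower[OF bdd that])
      moreover have "L * dist x s \<le> L * (dist x y + dist y s)"
        using L0 by (intro mult_left_mono dist_triangle)
      ultimately show ?thesis by (simp add: algebra_simps)
    qed
    then have "F x - L * dist x y \<le> F y" unfolding F_def by (intro cINF_greatest[OF False])
    then show ?thesis by simp
  qed
  show ?thesis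
  proof (rule that[of F])
    show "L-lipschitz_on UNIV F"
    proof (rule lipschitz_onI)
      show "dist (F x) (F y) \<le> L * dist x y" for x y
        using le[of x y] le[of y x] by (simp add: dist_real_def dist_commute abs_le_iff)
    qed (rule L0)
    show "F x = g x" if x: "x \<in> S" for x
    proof (rule antisym)
      show "F x \<le> g x" unfolding F_def using cINF_lower[OF bdd x, of x] by simp
      show "g x \<le> F x" unfolding F_def
      proof (rule cINF_greatest[OF False])
        show "g x \<le> g s + L * dist x s" if "s \<in> S" for s using lipD[OF x that] by simp
      qed
    qed
  qed
qed

text \<open>
  \<open>X\<close> is an arbitrary set. Rademacher's theorem is applied to extensions of \<open>g\<close> from countably many balls that
  cover \<open>X\<close>; differentiability of an extension at \<open>x\<close> restricts to differentiability of \<open>g\<close> within \<open>X\<close>.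
\<close>

lemma locally_lipschitz_differentiable_ae:
  fixes g :: "'a::euclidean_space \<Rightarrow> real"
  assumes "locally_lipschitz_on X g"
  shows "AE x\<in>X in lebesgue. g differentiable (at x within X)"
proof -
  obtain u L where u: "\<And>x. x \<in> X \<Longrightarrow> u x > 0"
    and lip: "\<And>x. x \<in> X \<Longrightarrow> (L x)-lipschitz_on (cball x (u x) \<inter> X) g"
    using assms unfolding locally_lipschitz_on_def by metis
  obtain \<C> where \<C>: "\<C> \<subseteq> (\<lambda>x. ball x (u x)) ` X" "countable \<C>" "\<Union>\<C> = (\<Union>x\<in>X. ball x (u x))"
    using Lindelof[of "(\<lambda>x. ball x (u x)) ` X"] by auto
  have "AE x in lebesgue. x \<in> X \<inter> B \<longrightarrow> g differentiable (at x within X)" if B: "B \<in> \<C>" for B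
  proof -
    obtain c where c: "c \<in> X" "B = ball c (u c)" using \<C>(1) B by blast
    obtain F where F: "(L c)-lipschitz_on UNIV F" "\<And>x. x \<in> cball c (u c) \<inter> X \<Longrightarrow> F x = g x"
      using lipschitz_extension_real[OF lip[OF c(1)]] by blast
    from Rademacher[OF F(1)] show ?thesis
    proof eventually_elim
      case (elim x)
      show ?case
      proof
        assume x: "x \<in> X \<inter> B"
        have "open B" using c by simp
        then obtain \<delta> where \<delta>: "\<delta> > 0" "ball x \<delta> \<subseteq> B" using x open_contains_ball by blast
        have "F differentiable (at x within X)" using elim differentiable_at_withinI by blast
        then show "g differentiable (at x within X)"
        proof (rule differentiable_transform_within[OF _ \<delta>(1)])
          show "F x' = g x'" if "x' \<in> X" "dist x' x < \<delta>" for x'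
            using that \<delta> c by (intro F(2)) (auto simp: dist_commute subset_iff)
        qed (use x in auto)
      qed
    qed
  qed
  then have "AE x in lebesgue. \<forall>B\<in>\<C>. x \<in> X \<inter> B \<longrightarrow> g differentiable (at x within X)"
    by (subst AE_ball_countable[OF \<C>(2)]) blast
  then show ?thesis
  proof eventually_elim
    case (elim x)
    show ?case
    proof
      assume "x \<in> X"
      then have "x \<in> \<Union>\<C>" using \<C>(3) u by (auto intro!: bexI[of _ x])
      then show "g differentiable (at x within X)" using elim \<open>x \<in> X\<close> by blast
    qed
  qed
qed

section \<open>Locally Lipschitz maps and flows\<close>

lemma locally_lipschitz_on_imp_continuous_on:
  assumes "locally_lipschitz_on X g"
  shows "continuous_on X g"
  unfolding continuous_on_eq_continuous_within
proof
  fix x assume x: "x \<in> X"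
  then obtain u L where u: "u > 0" and L: "L-lipschitz_on (cball x u \<inter> X) g"
    using assms unfolding locally_lipschitz_on_def by blast
  have "continuous (at x within cball x u \<inter> X) g"
    using lipschitz_on_continuous_within[OF L] x u by simp
  moreover have "at x within cball x u \<inter> X = at x within X"
    by (rule at_within_nhd[of _ "ball x u"]) (use u in auto)
  ultimately show "continuous (at x within X) g" by simp
qed

lemma locally_lipschitz_on_subset:
  "locally_lipschitz_on X g \<Longrightarrow> Y \<subseteq> X \<Longrightarrow> locally_lipschitz_on Y g"
  unfolding locally_lipschitz_on_def
  by (meson inf_mono lipschitz_on_subset order_refl subsetD)

text \<open>
  Points off \<open>K\<close> but close to it are included, since the trajectories to be compared with a given
  trajectory need not run through it.
\<close>

lemma lipschitz_near_compact:
  fixes g :: "'a::metric_space \<Rightarrow> 'b::metric_space"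
  assumes lip: "locally_lipschitz_on X g" and K: "compact K" "K \<subseteq> X"
  obtains u L where "u > 0" "0 \<le> L" "\<And>p. p \<in> K \<Longrightarrow> L-lipschitz_on (ball p u \<inter> X) g"
proof -
  have "\<forall>x\<in>K. \<exists>u L. u > 0 \<and> L-lipschitz_on (cball x u \<inter> X) g"
    using lip K unfolding locally_lipschitz_on_def by blast
  then obtain u L where u: "\<And>x. x \<in> K \<Longrightarrow> u x > 0"
    and L: "\<And>x. x \<in> K \<Longrightarrow> (L x)-lipschitz_on (cball x (u x) \<inter> X) g"
    by metis
  have "K \<subseteq> (\<Union>x\<in>K. ball x (u x))" using u by force
  then obtain C where C: "C \<subseteq> K" "finite C" "K \<subseteq> (\<Union>x\<in>C. ball x (u x))"
    using compactE_image[OF K(1), of K "\<lambda>x. ball x (u x)"] by auto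
  obtain e where e: "e > 0" "\<And>p. p \<in> K \<Longrightarrow> \<exists>B\<in>(\<lambda>x. ball x (u x)) ` C. ball p e \<subseteq> B"
    using Heine_Borel_lemma[OF K(1) C(3)] by auto
  define M where "M = Max (insert 0 (L ` C))"
  have M: "0 \<le> M" "\<And>x. x \<in> C \<Longrightarrow> L x \<le> M" using C(2) by (auto simp: M_def)
  have "M-lipschitz_on (ball p e \<inter> X) g" if p: "p \<in> K" for p
  proof -
    obtain x where x: "x \<in> C" "ball p e \<subseteq> ball x (u x)" using e(2)[OF p] by auto
    then show ?thesis
      using C(1) by (intro lipschitz_on_mono[OF L[of x] _ M(2)]) auto
  qed
  then show ?thesis using that e(1) M(1) by blast
qed

lemma locally_lipschitz_on_compose:
  assumes g: "locally_lipschitz_on X g" and h: "locally_lipschitz_on Y h" and "g ` X \<subseteq> Y"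
  shows "locally_lipschitz_on X (\<lambda>x. h (g x))"
  unfolding locally_lipschitz_on_def
proof
  fix x assume x: "x \<in> X"
  then obtain u L where u: "u > 0" and L: "L-lipschitz_on (cball x u \<inter> X) g"
    using g unfolding locally_lipschitz_on_def by blast
  obtain v M where v: "v > 0" and M: "M-lipschitz_on (cball (g x) v \<inter> Y) h"
    using h x assms(3) unfolding locally_lipschitz_on_def by (metis image_subset_iff)
  have L0: "0 \<le> L" using L by (rule lipschitz_on_nonneg)
  define w where "w = min u (v / (L + 1))"
  have w: "w > 0" "w \<le> u" "L * w \<le> v"
  proof -
    show "w > 0" "w \<le> u" using u v L0 by (auto simp: w_def)
    have "L * w \<le> (L + 1) * (v / (L + 1))" using \<open>w > 0\<close> L0 v
      by (intro mult_mono) (auto simp: w_def)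
    then show "L * w \<le> v" using L0 by simp
  qed
  have L': "L-lipschitz_on (cball x w \<inter> X) g"
    by (rule lipschitz_on_subset[OF L]) (use w in auto)
  have "g ` (cball x w \<inter> X) \<subseteq> cball (g x) v \<inter> Y"
  proof clarify
    fix y assume y: "y \<in> cball x w" "y \<in> X"
    have "dist (g x) (g y) \<le> L * dist x y"
      using y x w by (intro lipschitz_onD[OF L']) auto
    also have "\<dots> \<le> L * w" using y L0 by (intro mult_left_mono) auto
    finally show "g y \<in> cball (g x) v \<inter> Y" using w y assms(3) by auto
  qed
  then have "(M * L)-lipschitz_on (cball x w \<inter> X) (\<lambda>x. h (g x))"
    by (intro lipschitz_on_compose2[OF L'] lipschitz_on_subset[OF M])
  then show "\<exists>u>0. \<exists>L. L-lipschitz_on (cball x u \<inter> X) (\<lambda>x. h (g x))" using w by blast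
qed

lemma C1_real_lipschitz_on_interval:
  fixes h h' :: "real \<Rightarrow> real"
  assumes der: "\<And>y. a \<le> y \<Longrightarrow> y \<le> b \<Longrightarrow> (h has_real_derivative h' y) (at y)"
    and cont: "continuous_on {a..b} h'"
  obtains L where "L-lipschitz_on {a..b} h"
proof -
  have "bounded (h' ` {a..b})"
    by (intro compact_imp_bounded compact_continuous_image cont) auto
  then obtain L where L: "L > 0" "\<And>y. y \<in> {a..b} \<Longrightarrow> norm (h' y) \<le> L"
    by (auto simp: bounded_pos)
  have "norm (h x - h y) \<le> L * norm (x - y)" if "x \<in> {a..b}" "y \<in> {a..b}" for x y
    by (rule field_differentiable_bound[of "{a..b}" h h'])
       (use that L der in \<open>auto intro: has_field_derivative_at_within\<close>)
  then have "L-lipschitz_on {a..b} h"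
    using L by (auto intro!: lipschitz_onI simp: dist_norm)
  then show ?thesis by (rule that)
qed

lemma C1_locally_lipschitz_on_pos:
  fixes h h' :: "real \<Rightarrow> real"
  assumes der: "\<And>y. 0 < y \<Longrightarrow> (h has_real_derivative h' y) (at y)"
    and cont: "continuous_on {0<..} h'"
  shows "locally_lipschitz_on {0<..} h"
  unfolding locally_lipschitz_on_def
proof
  fix x :: real assume "x \<in> {0<..}"
  then have x: "0 < x" by simp
  have "continuous_on {x / 2..3 * x / 2} h'" by (rule continuous_on_subset[OF cont]) (use x in auto)
  then obtain L where "L-lipschitz_on {x / 2..3 * x / 2} h"
    using C1_real_lipschitz_on_interval[of "x / 2" "3 * x / 2" h h'] der x by auto
  then have "L-lipschitz_on (cball x (x / 2) \<inter> {0<..}) h"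
    by (rule lipschitz_on_subset) (auto simp: dist_real_def abs_if field_simps split: if_splits)
  then show "\<exists>u>0. \<exists>L. L-lipschitz_on (cball x u \<inter> {0<..}) h" using x by (intro exI[of _ "x / 2"]) auto
qed

text \<open>
  The derivative of \<open>w t \<bullet> w t\<close> is at most \<open>2 * L * (w t \<bullet> w t)\<close> in absolute value, so this square, multiplied by
  \<open>exp (\<sigma> * 2 * L * t)\<close>, is nondecreasing for \<open>\<sigma> = 1\<close> and nonincreasing for \<open>\<sigma> = -1\<close>. The second bound, which runs
  backwards in time, keeps a solution from reaching an equilibrium.
\<close>

lemma gronwall_two_sided:
  fixes w w' :: "real \<Rightarrow> 'a::real_inner"
  assumes der: "\<And>t. 0 \<le> t \<Longrightarrow> t \<le> T \<Longrightarrow> (w has_vector_derivative w' t) (at t within {0..T})"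
    and bound: "\<And>t. 0 \<le> t \<Longrightarrow> t \<le> T \<Longrightarrow> norm (w' t) \<le> L * norm (w t)"
    and T: "0 \<le> T" and L: "0 \<le> L"
  shows "norm (w T) \<le> exp (L * T) * norm (w 0)" "norm (w 0) \<le> exp (L * T) * norm (w T)"
proof -
  have derE: "((\<lambda>t. (w t \<bullet> w t) * exp (c * t)) has_derivative
      (\<lambda>h. h * ((2 * (w t \<bullet> w' t) + c * (w t \<bullet> w t)) * exp (c * t)))) (at t within {0..T})"
    if "0 \<le> t" "t \<le> T" for t c
  proof -
    have "(w has_derivative (\<lambda>h. h *\<^sub>R w' t)) (at t within {0..T})"
      using der[OF that] by (simp add: has_vector_derivative_def)
    then show ?thesis
      by (auto intro!: derivative_eq_intros simp: algebra_simps inner_commute)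
  qed
  have inner: "\<bar>w t \<bullet> w' t\<bar> \<le> L * (w t \<bullet> w t)" if "0 \<le> t" "t \<le> T" for t
  proof -
    have "\<bar>w t \<bullet> w' t\<bar> \<le> norm (w t) * norm (w' t)" by (rule Cauchy_Schwarz_ineq2)
    also have "\<dots> \<le> norm (w t) * (L * norm (w t))" by (intro mult_left_mono bound that) auto
    finally show ?thesis by (simp add: dot_square_norm power2_eq_square mult.left_commute)
  qed
  have mono: "\<sigma> * ((w T \<bullet> w T) * exp (\<sigma> * 2 * L * T) - (w 0 \<bullet> w 0)) \<ge> 0" if \<sigma>: "\<sigma> = 1 \<or> \<sigma> = -1" for \<sigma>
  proof -
    obtain t where t: "0 \<le> t" "t \<le> T"
      "(w T \<bullet> w T) * exp (\<sigma> * 2 * L * T) - (w 0 \<bullet> w 0) * exp (\<sigma> * 2 * L * 0) =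
        (T - 0) * ((2 * (w t \<bullet> w' t) + \<sigma> * 2 * L * (w t \<bullet> w t)) * exp (\<sigma> * 2 * L * t))"
      using mvt_very_simple[OF T derE[of _ "\<sigma> * 2 * L"]] by auto
    have "\<sigma> * (2 * (w t \<bullet> w' t) + \<sigma> * 2 * L * (w t \<bullet> w t)) \<ge> 0"
      using inner[OF t(1,2)] \<sigma> by (auto simp: algebra_simps)
    then have "T * ((\<sigma> * (2 * (w t \<bullet> w' t) + \<sigma> * 2 * L * (w t \<bullet> w t))) * exp (\<sigma> * 2 * L * t)) \<ge> 0"
      by (rule mult_nonneg_nonneg[OF T mult_nonneg_nonneg[OF _ exp_ge_zero]])
    also have "\<dots> = \<sigma> * ((w T \<bullet> w T) * exp (\<sigma> * 2 * L * T) - (w 0 \<bullet> w 0))"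
      using t(3) by (simp add: mult_ac)
    finally show ?thesis .
  qed
  have sq: "norm a \<le> exp (L * T) * norm b" if "a \<bullet> a \<le> exp (2 * L * T) * (b \<bullet> b)" for a b :: 'a
  proof (rule power2_le_imp_le)
    have "exp (2 * L * T) = (exp (L * T))\<^sup>2" by (simp add: power2_eq_square flip: exp_add)
    then show "(norm a)\<^sup>2 \<le> (exp (L * T) * norm b)\<^sup>2"
      using that by (simp add: dot_square_norm power_mult_distrib)
  qed auto
  show "norm (w T) \<le> exp (L * T) * norm (w 0)"
  proof (rule sq)
    have "(w T \<bullet> w T) * exp (- (2 * L * T)) \<le> w 0 \<bullet> w 0" using mono[of "-1"] by simp
    then show "w T \<bullet> w T \<le> exp (2 * L * T) * (w 0 \<bullet> w 0)"
      by (simp add: exp_minus field_simps)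
  qed
  show "norm (w 0) \<le> exp (L * T) * norm (w T)"
  proof (rule sq)
    show "w 0 \<bullet> w 0 \<le> exp (2 * L * T) * (w T \<bullet> w T)"
      using mono[of 1] by (simp add: mult.commute)
  qed
qed

text \<open>
  Along a compact piece of a trajectory \<open>norm (f p) \<le> C * norm p\<close>: near \<open>0\<close> by the Lipschitz condition at the
  equilibrium, elsewhere because \<open>f\<close> is bounded there. Gronwall backwards in time then gives
  \<open>norm x \<le> exp (C * T) * norm (\<phi> x T)\<close>.
\<close>

lemma flow_avoids_equilibrium:
  assumes sol: "is_solution_map \<Omega> f \<phi>" and lip: "locally_lipschitz_on \<Omega> f"
    and zero: "0 \<in> \<Omega>" "f 0 = 0" and x: "x \<in> \<Omega>" "x \<noteq> 0" and T: "0 \<le> T"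
  shows "\<phi> x T \<noteq> 0"
proof
  assume end0: "\<phi> x T = 0"
  have traj: "\<phi> x 0 = x" "\<And>t. 0 \<le> t \<Longrightarrow> \<phi> x t \<in> \<Omega>"
    "\<And>t. 0 \<le> t \<Longrightarrow> (\<phi> x has_vector_derivative f (\<phi> x t)) (at t within {0..})"
    using sol x unfolding is_solution_map_def ode_solution_def by auto
  have contf: "continuous_on \<Omega> f" by (rule locally_lipschitz_on_imp_continuous_on[OF lip])
  have cont\<phi>: "continuous_on {0..T} (\<phi> x)"
    using continuous_on_vector_derivative[of "{0..}" "\<phi> x" "\<lambda>t. f (\<phi> x t)"] traj(3)
    by (auto intro: continuous_on_subset)
  obtain u L where u: "u > 0" and L: "L-lipschitz_on (cball 0 u \<inter> \<Omega>) f"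
    using lip zero unfolding locally_lipschitz_on_def by blast
  have L0: "0 \<le> L" using L by (rule lipschitz_on_nonneg)
  have "compact ((\<lambda>t. f (\<phi> x t)) ` {0..T})"
    by (intro compact_continuous_image continuous_on_compose2[OF contf cont\<phi>]) (use traj in auto)
  then have "bounded ((\<lambda>t. f (\<phi> x t)) ` {0..T})" by (rule compact_imp_bounded)
  then obtain M where M: "M > 0" "\<forall>p\<in>(\<lambda>t. f (\<phi> x t)) ` {0..T}. norm p \<le> M"
    unfolding bounded_pos by blast
  define C where "C = max L (M / u)"
  have linear_growth: "norm (f (\<phi> x t)) \<le> C * norm (\<phi> x t)" if t: "0 \<le> t" "t \<le> T" for t
  proof (cases "norm (\<phi> x t) \<le> u")
    case True
    then have "norm (f (\<phi> x t) - f 0) \<le> L * norm (\<phi> x t - 0)"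
      using u zero traj(2) t by (intro lipschitz_on_normD[OF L]) auto
    also have "\<dots> \<le> C * norm (\<phi> x t - 0)" by (intro mult_right_mono) (auto simp: C_def)
    finally show ?thesis using zero by simp
  next
    case False
    have "norm (f (\<phi> x t)) \<le> M / u * u" using M(2) t u by simp
    also have "\<dots> \<le> C * norm (\<phi> x t)"
      using False u M(1) by (intro mult_mono) (auto simp: C_def le_max_iff_disj)
    finally show ?thesis .
  qed
  have "norm (\<phi> x 0) \<le> exp (C * T) * norm (\<phi> x T)"
    by (rule gronwall_two_sided(2)[where w' = "\<lambda>t. f (\<phi> x t)"])
       (use linear_growth T L0 in \<open>auto intro!: has_vector_derivative_within_subset[OF traj(3)] simp: C_def\<close>)
  then show False using end0 traj x by simp
qed

lemma flow_uniformly_continuous_initial: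
  fixes \<phi> :: "'a::metric_space \<Rightarrow> real \<Rightarrow> 'b::metric_space"
  assumes cont: "continuous_on (X \<times> {0..}) (\<lambda>(x, t). \<phi> x t)" and x: "x \<in> X" and r: "0 < r"
  obtains \<delta> where "\<delta> > 0"
    "\<And>x' t. x' \<in> X \<Longrightarrow> dist x x' < \<delta> \<Longrightarrow> 0 \<le> t \<Longrightarrow> t \<le> T \<Longrightarrow> dist (\<phi> x' t) (\<phi> x t) \<le> r"
proof -
  have "continuous_on (X \<times> {0..T}) (\<lambda>(x, t). \<phi> x t)"
    by (rule continuous_on_subset[OF cont]) auto
  then obtain U where "x \<in> U" "open U"
    "\<forall>x'\<in>U \<inter> X. \<forall>t\<in>{0..T}. dist (case (x', t) of (x, t) \<Rightarrow> \<phi> x t) (case (x, t) of (x, t) \<Rightarrow> \<phi> x t) \<le> r"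
    by (rule continuous_on_prod_compactE[OF _ _ x r]) auto
  moreover from this obtain \<delta> where "\<delta> > 0" "ball x \<delta> \<subseteq> U" using open_contains_ball by blast
  ultimately show ?thesis by (intro that[of \<delta>]) (auto simp: subset_iff)
qed

text \<open>
  Up to time \<open>T\<close>, trajectories that start near \<open>x\<close> stay at each time within a ball around \<open>\<phi> x t\<close> on which \<open>f\<close> is
  Lipschitz, with a constant that does not depend on \<open>t\<close>. Gronwall then compares any two of them.
\<close>

lemma flow_locally_lipschitz_initial:
  assumes sol: "is_solution_map \<Omega> f \<phi>" and lip: "locally_lipschitz_on \<Omega> f"
    and x: "x \<in> \<Omega>" and T: "0 \<le> T"
  obtains \<delta> L where "\<delta> > 0" "0 \<le> L"
    "\<And>x' x'' t. x' \<in> \<Omega> \<Longrightarrow> dist x x' < \<delta> \<Longrightarrow> x'' \<in> \<Omega> \<Longrightarrow> dist x x'' < \<delta> \<Longrightarrow> 0 \<le> t \<Longrightarrow> t \<le> T \<Longrightarrow>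
      norm (\<phi> x' t - \<phi> x'' t) \<le> L * norm (x' - x'')"
proof -
  have traj: "\<phi> x 0 = x" "\<And>t. 0 \<le> t \<Longrightarrow> \<phi> x t \<in> \<Omega>"
    "\<And>t. 0 \<le> t \<Longrightarrow> (\<phi> x has_vector_derivative f (\<phi> x t)) (at t within {0..})" if "x \<in> \<Omega>" for x
    using sol that unfolding is_solution_map_def ode_solution_def by auto
  have cont: "continuous_on (\<Omega> \<times> {0..}) (\<lambda>(x, t). \<phi> x t)"
    using sol by (simp add: is_solution_map_def)
  have "continuous_on {0..T} (\<phi> x)"
    using continuous_on_vector_derivative[of "{0..}" "\<phi> x" "\<lambda>t. f (\<phi> x t)"] traj(3)[OF x]
    by (auto intro: continuous_on_subset)
  then have "compact (\<phi> x ` {0..T})" by (intro compact_continuous_image) auto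
  then obtain u C where u: "u > 0" and C: "0 \<le> C"
    and Cu: "\<And>p. p \<in> \<phi> x ` {0..T} \<Longrightarrow> C-lipschitz_on (ball p u \<inter> \<Omega>) f"
    by (rule lipschitz_near_compact[OF lip]) (use traj[OF x] in auto)
  obtain \<delta> where \<delta>: "\<delta> > 0"
    "\<And>x' t. x' \<in> \<Omega> \<Longrightarrow> dist x x' < \<delta> \<Longrightarrow> 0 \<le> t \<Longrightarrow> t \<le> T \<Longrightarrow> dist (\<phi> x' t) (\<phi> x t) \<le> u / 2"
    using flow_uniformly_continuous_initial[OF cont x, of "u / 2" T] u by auto
  show ?thesis
  proof (rule that[OF \<delta>(1), of "exp (C * T)"])
    fix x' x'' t assume x': "x' \<in> \<Omega>" "dist x x' < \<delta>" and x'': "x'' \<in> \<Omega>" "dist x x'' < \<delta>"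
      and t: "0 \<le> t" "t \<le> T"
    have "norm (\<phi> x' t - \<phi> x'' t) \<le> exp (C * t) * norm (\<phi> x' 0 - \<phi> x'' 0)"
    proof (rule gronwall_two_sided(1)[where w = "\<lambda>t. \<phi> x' t - \<phi> x'' t"
          and w' = "\<lambda>t. f (\<phi> x' t) - f (\<phi> x'' t)"])
      fix s assume s: "0 \<le> s" "s \<le> t"
      show "((\<lambda>t. \<phi> x' t - \<phi> x'' t) has_vector_derivative f (\<phi> x' s) - f (\<phi> x'' s)) (at s within {0..t})"
        using s by (intro has_vector_derivative_diff has_vector_derivative_within_subset[OF traj(3)] x' x'') auto
      have "s \<in> {0..T}" using s t by auto
      then have "C-lipschitz_on (ball (\<phi> x s) u \<inter> \<Omega>) f" by (intro Cu imageI)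
      then show "norm (f (\<phi> x' s) - f (\<phi> x'' s)) \<le> C * norm (\<phi> x' s - \<phi> x'' s)"
      proof (rule lipschitz_on_normD)
        show "\<phi> x' s \<in> ball (\<phi> x s) u \<inter> \<Omega>" "\<phi> x'' s \<in> ball (\<phi> x s) u \<inter> \<Omega>"
          using \<delta>(2)[OF x'] \<delta>(2)[OF x''] s t u traj(2) x' x'' by (auto simp: dist_commute field_simps) force+
      qed
    qed (use t C in auto)
    also have "\<dots> \<le> exp (C * T) * norm (x' - x'')"
      using t C traj(1) x' x'' by (intro mult_mono) (auto intro: mult_left_mono)
    finally show "norm (\<phi> x' t - \<phi> x'' t) \<le> exp (C * T) * norm (x' - x'')" .
  qed auto
qed

section \<open>The scalar comparison flow\<close>

text \<open>
  Uniqueness enters here: following \<open>\<beta>\<close> up to time \<open>s\<close> and then restarting it at \<open>\<beta> y s\<close> is again a continuous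
  flow with rate \<open>\<rho>\<close>.
\<close>

lemma rate_flow_semigroup:
  assumes uniq: "is_unique_rate_flow \<rho> \<beta>" and "0 \<le> y" "0 \<le> s" "0 \<le> t"
  shows "\<beta> (\<beta> y s) t = \<beta> y (s + t)"
proof -
  have rf: "rate_flow \<rho> \<beta>" using uniq by (simp add: is_unique_rate_flow_def)
  then have cont: "continuous_on ({0..} \<times> {0..}) (\<lambda>p. \<beta> (fst p) (snd p))"
    and nonneg: "\<And>y t. 0 \<le> y \<Longrightarrow> 0 \<le> t \<Longrightarrow> 0 \<le> \<beta> y t"
    and init: "\<And>y. 0 \<le> y \<Longrightarrow> \<beta> y 0 = y"
    and der: "\<And>y t. 0 \<le> y \<Longrightarrow> 0 \<le> t \<Longrightarrow> (\<beta> y has_vector_derivative \<rho> (\<beta> y t)) (at t within {0..})"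
    unfolding rate_flow_def has_real_derivative_iff_has_vector_derivative by (auto simp: case_prod_unfold)
  define \<beta>' where "\<beta>' = (\<lambda>y t. if t \<le> s then \<beta> y t else \<beta> (\<beta> y s) (t - s))"
  have "continuous_on ({0..} \<times> {0..})
      (\<lambda>p. if snd p \<le> s then \<beta> (fst p) (snd p) else \<beta> (\<beta> (fst p) s) (snd p - s))"
  proof (rule continuous_on_cases_le)
    show "continuous_on {p \<in> {0..} \<times> {0..}. snd p \<le> s} (\<lambda>p. \<beta> (fst p) (snd p))"
      by (rule continuous_on_subset[OF cont]) auto
    have c1: "continuous_on {p \<in> {0..} \<times> {0..}. s \<le> snd p} (\<lambda>p. \<beta> (fst p) s)"
      by (rule continuous_on_compose2[OF cont, of _ "\<lambda>p. (fst p, s)", simplified])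
         (use \<open>0 \<le> s\<close> in \<open>auto intro!: continuous_intros\<close>)
    have "continuous_on {p \<in> {0..} \<times> {0..}. s \<le> snd p}
        (\<lambda>p. (\<lambda>q. \<beta> (fst q) (snd q)) (\<beta> (fst p) s, snd p - s))"
      by (rule continuous_on_compose2[OF cont])
         (intro continuous_on_Pair c1 continuous_intros, use \<open>0 \<le> s\<close> nonneg in auto)
    then show "continuous_on {p \<in> {0..} \<times> {0..}. s \<le> snd p} (\<lambda>p. \<beta> (\<beta> (fst p) s) (snd p - s))"
      by simp
    show "continuous_on ({0..} \<times> {0..}) (snd :: real \<times> real \<Rightarrow> real)" by (intro continuous_intros)
    fix p :: "real \<times> real" assume "p \<in> {0..} \<times> {0..}" "snd p = s"
    then show "\<beta> (fst p) (snd p) = \<beta> (\<beta> (fst p) s) (snd p - s)"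
      using init nonneg \<open>0 \<le> s\<close> by auto
  qed
  then have "continuous_on ({0..} \<times> {0..}) (\<lambda>(y, t). \<beta>' y t)"
    by (simp add: \<beta>'_def case_prod_unfold)
  moreover have "0 \<le> \<beta>' y t" if "0 \<le> y" "0 \<le> t" for y t
    using that nonneg \<open>0 \<le> s\<close> by (auto simp: \<beta>'_def)
  moreover have "\<beta>' y 0 = y" if "0 \<le> y" for y
    using that init \<open>0 \<le> s\<close> by (auto simp: \<beta>'_def)
  moreover have "(\<beta>' y has_vector_derivative \<rho> (\<beta>' y t)) (at t within {0..})" if y: "0 \<le> y" and t: "0 \<le> t" for y t
  proof -
    have z: "0 \<le> \<beta> y s" using nonneg y \<open>0 \<le> s\<close> by simp
    have late: "((\<lambda>t. \<beta> (\<beta> y s) (t - s)) has_vector_derivative \<rho> (\<beta> (\<beta> y s) (t - s))) (at t within {s..})"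
      if "s \<le> t"
    proof -
      have "(\<lambda>t. t - s) ` {s..} = {0..}" by (auto simp: image_iff intro!: exI[of _ "_ + s"] bexI[of _ "_ + s"])
      then have "((\<beta> (\<beta> y s) \<circ> (\<lambda>t. t - s)) has_vector_derivative 1 *\<^sub>R \<rho> (\<beta> (\<beta> y s) (t - s))) (at t within {s..})"
        using der[OF z, of "t - s"] that
        by (intro vector_diff_chain_within) (auto intro!: derivative_eq_intros)
      then show ?thesis by (simp add: o_def)
    qed
    have "((\<lambda>t. if t \<in> {0..s} then \<beta> y t else \<beta> (\<beta> y s) (t - s)) has_vector_derivative
        (if t \<in> {0..s} then \<rho> (\<beta> y t) else \<rho> (\<beta> (\<beta> y s) (t - s)))) (at t within {0..})"
    proof (rule has_vector_derivative_If_within_closures[where T = "{s..}"])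
      show "{0..} = {0..s} \<union> {s..}" using \<open>0 \<le> s\<close> by auto
      show "t \<in> {0..s} \<union> {s..}" using t by auto
      show "(\<beta> y has_vector_derivative \<rho> (\<beta> y t)) (at t within {0..s} \<union> closure {0..s} \<inter> closure {s..})"
        by (rule has_vector_derivative_within_subset[OF der[OF y t]]) (use \<open>0 \<le> s\<close> in auto)
      show "((\<lambda>t. \<beta> (\<beta> y s) (t - s)) has_vector_derivative \<rho> (\<beta> (\<beta> y s) (t - s)))
          (at t within {s..} \<union> closure {0..s} \<inter> closure {s..})"
        if "t \<in> {s..} \<union> closure {0..s} \<inter> closure {s..}"
        by (rule has_vector_derivative_within_subset[OF late]) (use that in auto)
    qed (use init z in auto)
    then have "(\<beta>' y has_vector_derivative
        (if t \<in> {0..s} then \<rho> (\<beta> y t) else \<rho> (\<beta> (\<beta> y s) (t - s)))) (at t within {0..})"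
      by (rule has_vector_derivative_transform[rotated 2]) (use t in \<open>auto simp: \<beta>'_def\<close>)
    then show ?thesis using t by (simp add: \<beta>'_def split: if_splits)
  qed
  ultimately have "rate_flow \<rho> \<beta>'"
    unfolding rate_flow_def has_real_derivative_iff_has_vector_derivative by blast
  then have "\<beta>' y (s + t) = \<beta> y (s + t)"
    using uniq assms by (simp add: is_unique_rate_flow_def)
  then show ?thesis using init nonneg assms by (auto simp: \<beta>'_def split: if_splits)
qed

lemma rate_flow_pos:
  assumes rf: "rate_flow \<rho> \<beta>" and dec: "\<forall>y>0. strict_antimono_on {0..} (\<beta> y)"
    and "0 < y" "0 \<le> t"
  shows "0 < \<beta> y t"
proof -
  have "0 \<le> \<beta> y (t + 1)" using rf assms by (simp add: rate_flow_def)
  also have "\<beta> y (t + 1) < \<beta> y t"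
    using dec assms by (auto simp: monotone_on_def)
  finally show ?thesis .
qed

text \<open>
  Strict decrease alone would allow isolated zeros of \<open>\<rho>\<close>, as for \<open>\<rho> y = - sqrt \<bar>y - 1\<bar>\<close> near \<open>y = 1\<close>. The
  Lipschitz condition on \<open>\<beta>\<close> excludes them. If \<open>\<rho> y0 \<ge> 0\<close>, a solution from \<open>y\<close> slightly above \<open>y0\<close> arrives at \<open>y0\<close>
  after a time \<open>s\<close> with \<open>y - y0 = o(s)\<close>. By the semigroup property it then stays behind the solution from \<open>y0\<close> by
  the time \<open>s\<close>, so at a time \<open>t1\<close> at which the latter moves with nonzero speed the two differ by at least a multiple of
  \<open>s\<close>, which no Lipschitz constant at \<open>(y0, t1)\<close> permits.
\<close>

lemma rate_negative:
  assumes uniq: "is_unique_rate_flow \<rho> \<beta>" and dec: "\<forall>y>0. strict_antimono_on {0..} (\<beta> y)"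
    and lip: "locally_lipschitz_on ({0..} \<times> {0..}) (\<lambda>(y, t). \<beta> y t)"
    and cont\<rho>: "continuous_on {0<..} \<rho>"
    and y0: "0 < y0"
  shows "\<rho> y0 < 0"
proof (rule ccontr)
  assume "\<not> \<rho> y0 < 0"
  then have \<rho>0: "0 \<le> \<rho> y0" by simp
  have rf: "rate_flow \<rho> \<beta>" using uniq by (simp add: is_unique_rate_flow_def)
  then have cont: "continuous_on ({0..} \<times> {0..}) (\<lambda>p. \<beta> (fst p) (snd p))"
    and init: "\<And>y. 0 \<le> y \<Longrightarrow> \<beta> y 0 = y"
    and der: "\<And>y t. 0 \<le> y \<Longrightarrow> 0 \<le> t \<Longrightarrow> (\<beta> y has_real_derivative \<rho> (\<beta> y t)) (at t within {0..})"
    unfolding rate_flow_def by (auto simp: case_prod_unfold)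
  have decD: "\<beta> y t < \<beta> y s" if "0 < y" "0 \<le> s" "s < t" for y s t
    using dec that by (auto simp: monotone_on_def)
  have mvt: "\<exists>\<xi>\<in>{a<..<b}. \<beta> y b - \<beta> y a = (b - a) * \<rho> (\<beta> y \<xi>)" if "0 \<le> y" "0 \<le> a" "a < b" for y a b
  proof -
    have "\<exists>\<xi>\<in>{a<..<b}. \<beta> y b - \<beta> y a = (*) (\<rho> (\<beta> y \<xi>)) (b - a)"
    proof (rule mvt_simple[OF that(3)])
      fix t assume "a \<le> t" "t \<le> b"
      then show "(\<beta> y has_derivative (*) (\<rho> (\<beta> y t))) (at t within {a..b})"
        using DERIV_subset[OF der[of y t], of "{a..b}"] that by (auto simp: has_field_derivative_def)
    qed
    then show ?thesis by (simp add: mult.commute)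
  qed
  (* The solution from y0 decreases strictly, so at some time t1 it moves at a speed m > 0. *)
  obtain t1 where t1: "0 < t1" and neg: "\<rho> (\<beta> y0 t1) < 0"
    using mvt[of y0 0 1] decD[of y0 0 1] y0 by auto
  define m where "m = - \<rho> (\<beta> y0 t1)"
  have m: "m > 0" using neg by (simp add: m_def)
  obtain d where d: "d > 0" and speed: "\<And>s. 0 < s \<Longrightarrow> s < d \<Longrightarrow> s \<le> t1 \<Longrightarrow> m / 2 * s \<le> \<beta> y0 (t1 - s) - \<beta> y0 t1"
  proof -
    have "(\<beta> y0 has_derivative (*) (- m)) (at t1 within {0..})"
      using der[of y0 t1] y0 t1 by (simp add: m_def has_field_derivative_def)
    then obtain d where d: "d > 0" and *: "\<And>t. 0 \<le> t \<Longrightarrow> norm (t - t1) < d \<Longrightarrow>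
        norm (\<beta> y0 t - \<beta> y0 t1 - (- m) * (t - t1)) \<le> m / 2 * norm (t - t1)"
      unfolding has_derivative_within_alt using m by (metis atLeast_iff half_gt_zero)
    show ?thesis
    proof (rule that[OF d])
      fix s assume s: "0 < s" "s < d" "s \<le> t1"
      show "m / 2 * s \<le> \<beta> y0 (t1 - s) - \<beta> y0 t1"
      proof -
        have "\<bar>\<beta> y0 (t1 - s) - \<beta> y0 t1 - m * s\<bar> \<le> m / 2 * s" using *[of "t1 - s"] s by simp
        then show ?thesis by linarith
      qed
    qed
  qed
  obtain u L where u: "u > 0" and L: "L-lipschitz_on (cball (y0, t1) u \<inter> {0..} \<times> {0..}) (\<lambda>(y, t). \<beta> y t)"
    using lip y0 t1 unfolding locally_lipschitz_on_def by (metis SigmaI atLeast_iff less_imp_le)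
  have L0: "0 \<le> L" using L by (rule lipschitz_on_nonneg)
  define \<eta> where "\<eta> = m / 2 / (L + 1)"
  have \<eta>: "\<eta> > 0" "L * \<eta> < m / 2" using m L0 by (auto simp: \<eta>_def field_simps)
  obtain r where r: "r > 0" and slow: "\<And>z. \<bar>z - y0\<bar> < r \<Longrightarrow> 0 < z \<Longrightarrow> - \<eta> < \<rho> z"
  proof -
    obtain r where "r > 0" "\<And>z. z \<in> {0<..} \<Longrightarrow> dist z y0 < r \<Longrightarrow> dist (\<rho> z) (\<rho> y0) < \<eta>"
      using cont\<rho> y0 \<eta>(1) unfolding continuous_on_iff by (metis greaterThan_iff)
    then show ?thesis using \<rho>0 by (intro that[of r]) (fastforce simp: dist_real_def)+
  qed
  define \<delta> where "\<delta> = min d t1 / 2"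
  have \<delta>: "0 < \<delta>" "\<delta> < d" "\<delta> < t1" using d t1 by (auto simp: \<delta>_def min_def)
  obtain r' where r': "r' > 0" and reach: "\<And>y. 0 \<le> y \<Longrightarrow> \<bar>y - y0\<bar> < r' \<Longrightarrow> \<beta> y \<delta> < y0"
  proof -
    have "continuous_on {0..} (\<lambda>y. \<beta> y \<delta>)"
      by (rule continuous_on_compose2[OF cont, of _ "\<lambda>y. (y, \<delta>)", simplified])
         (use \<delta> in \<open>auto intro!: continuous_intros\<close>)
    moreover have "\<beta> y0 \<delta> < y0" using decD[of y0 0 \<delta>] init y0 \<delta> by simp
    ultimately obtain r' where "r' > 0"
      "\<And>z. z \<in> {0..} \<Longrightarrow> dist z y0 < r' \<Longrightarrow> dist (\<beta> z \<delta>) (\<beta> y0 \<delta>) < y0 - \<beta> y0 \<delta>"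
      using y0 unfolding continuous_on_iff by (metis atLeast_iff diff_gt_0_iff_gt less_imp_le)
    then show ?thesis by (intro that[of r']) (fastforce simp: dist_real_def)+
  qed
  define y where "y = y0 + min r (min r' u) / 2"
  have y: "y0 < y" "y - y0 < r" "y - y0 < r'" "y - y0 < u" "0 < y"
    using r r' u y0 by (auto simp: y_def min_def)
  have "\<exists>s\<ge>0. s \<le> \<delta> \<and> \<beta> y s = y0"
  proof (rule IVT2')
    show "\<beta> y \<delta> \<le> y0" using reach[of y] y by auto
    show "y0 \<le> \<beta> y 0" using init y by simp
    show "continuous_on {0..\<delta>} (\<beta> y)"
      by (rule continuous_on_compose2[OF cont, of _ "\<lambda>t. (y, t)", simplified])
         (use y in \<open>auto intro!: continuous_intros\<close>)
  qed (use \<delta> in simp)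
  then obtain s where s: "0 \<le> s" "s \<le> \<delta>" "\<beta> y s = y0" by blast
  have "s \<noteq> 0" using s init[of y] y by auto
  then have s0: "0 < s" using s by simp
  have "y - y0 \<le> \<eta> * s"
  proof -
    obtain \<xi> where \<xi>: "0 < \<xi>" "\<xi> < s" "\<beta> y s - \<beta> y 0 = s * \<rho> (\<beta> y \<xi>)"
      using mvt[of y 0 s] s0 y by auto
    have "y0 < \<beta> y \<xi>" "\<beta> y \<xi> < y"
      using decD[of y \<xi> s] decD[of y 0 \<xi>] \<xi> s y init[of y] by auto
    then have "- \<eta> < \<rho> (\<beta> y \<xi>)" using y y0 by (intro slow) auto
    then have "s * (- \<eta>) \<le> s * \<rho> (\<beta> y \<xi>)" using s0 by (intro mult_left_mono) auto
    then show ?thesis using \<xi>(3) s(3) init[of y] y by (simp add: mult.commute)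
  qed
  have "\<beta> y t1 = \<beta> y0 (t1 - s)"
    using rate_flow_semigroup[OF uniq, of y s "t1 - s"] s \<delta> y by simp
  then have "m / 2 * s \<le> \<beta> y t1 - \<beta> y0 t1"
    using speed[OF s0] s \<delta> by simp
  also have "\<dots> \<le> dist (case (y, t1) of (y, t) \<Rightarrow> \<beta> y t) (case (y0, t1) of (y, t) \<Rightarrow> \<beta> y t)"
    by (simp add: dist_real_def)
  also have "\<dots> \<le> L * dist (y, t1) (y0, t1)"
    by (rule lipschitz_onD[OF L]) (use y y0 t1 u in \<open>auto simp: dist_Pair_Pair dist_real_def\<close>)
  also have "\<dots> = L * (y - y0)" using y by (simp add: dist_Pair_Pair dist_real_def)
  also have "\<dots> \<le> L * (\<eta> * s)" using \<open>y - y0 \<le> \<eta> * s\<close> L0 by (rule mult_left_mono)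
  also have "\<dots> < m / 2 * s" using \<eta>(2) s0 by (simp add: mult.assoc[symmetric])
  finally show False by simp
qed

text \<open>
  \<open>\<tau> y\<close> is, up to an additive constant, the time at which a solution of the scalar equation passes the level \<open>y\<close>.
\<close>

lemma rate_time_coordinate:
  assumes rf: "rate_flow \<rho> \<beta>" and dec: "\<forall>y>0. strict_antimono_on {0..} (\<beta> y)"
    and cont\<rho>: "continuous_on {0<..} \<rho>" and neg: "\<And>y. 0 < y \<Longrightarrow> \<rho> y < 0"
  obtains \<tau> where "\<And>y. 0 < y \<Longrightarrow> (\<tau> has_real_derivative 1 / \<rho> y) (at y)"
    "\<And>y t. 0 < y \<Longrightarrow> 0 \<le> t \<Longrightarrow> \<tau> (\<beta> y t) = \<tau> y + t"
proof -
  have "\<exists>\<tau>. \<forall>y::real. ereal 0 < ereal y \<longrightarrow> ereal y < \<infinity> \<longrightarrow> (\<tau> has_vector_derivative 1 / \<rho> y) (at y)"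
  proof (rule einterval_antiderivative)
    fix y assume "ereal 0 < ereal y"
    then have "isCont \<rho> y" using cont\<rho> by (simp add: continuous_on_eq_continuous_at)
    then show "isCont (\<lambda>y. 1 / \<rho> y) y"
      using neg[of y] \<open>ereal 0 < ereal y\<close> by (intro continuous_intros) auto
  qed simp
  then obtain \<tau> where \<tau>: "\<And>y. 0 < y \<Longrightarrow> (\<tau> has_real_derivative 1 / \<rho> y) (at y)"
    by (auto simp: has_real_derivative_iff_has_vector_derivative)
  have "\<tau> (\<beta> y t) = \<tau> y + t" if y: "0 < y" and t: "0 \<le> t" for y t
  proof -
    have const: "((\<lambda>t. \<tau> (\<beta> y t) - t) has_real_derivative 0) (at t within {0..})" if "t \<in> {0..}" for t
    proof -
      have pos: "0 < \<beta> y t" using rate_flow_pos[OF rf dec y] that by simp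
      have "(\<beta> y has_real_derivative \<rho> (\<beta> y t)) (at t within {0..})"
        using rf y that by (simp add: rate_flow_def)
      from DERIV_chain2[OF \<tau>[OF pos] this] neg[OF pos]
      show ?thesis by (auto intro!: derivative_eq_intros)
    qed
    have "\<exists>c. \<forall>t\<in>{0..}. \<tau> (\<beta> y t) - t = c"
      by (rule has_field_derivative_zero_constant[OF _ const]) auto
    then obtain c where "\<forall>t\<in>{0..}. \<tau> (\<beta> y t) - t = c" ..
    then have "\<tau> (\<beta> y t) - t = c" "\<tau> (\<beta> y 0) - 0 = c" using t by blast+
    then have "\<tau> (\<beta> y t) - t = \<tau> (\<beta> y 0)" by simp
    then show ?thesis using rf y by (simp add: rate_flow_def)
  qed
  then show ?thesis using that \<tau> by blast
qed

section \<open>Infima along trajectories\<close>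

text \<open>
  \<open>P\<close> is the state space without the equilibrium. Along trajectories \<open>a\<close> has a lower bound
  of unit slope. The smaller slope \<open>\<kappa>\<close> is the rate of increase demanded of the function to be constructed; the
  difference \<open>1 - \<kappa>\<close> confines the infimum below to bounded times.
\<close>

locale trajectory_infimum =
  fixes P :: "'a::real_normed_vector set" and \<phi> :: "'a \<Rightarrow> real \<Rightarrow> 'a"
    and a b :: "'a \<Rightarrow> real" and \<kappa> :: real
  assumes inv: "\<And>x t. x \<in> P \<Longrightarrow> 0 \<le> t \<Longrightarrow> \<phi> x t \<in> P"
    and init: "\<And>x. x \<in> P \<Longrightarrow> \<phi> x 0 = x"
    and semi: "\<And>x s t. x \<in> P \<Longrightarrow> 0 \<le> s \<Longrightarrow> 0 \<le> t \<Longrightarrow> \<phi> (\<phi> x s) t = \<phi> x (s + t)"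
    and cont\<phi>: "continuous_on (P \<times> {0..}) (\<lambda>(x, t). \<phi> x t)"
    and lip\<phi>: "\<And>x T. x \<in> P \<Longrightarrow> 0 \<le> T \<Longrightarrow> \<exists>\<delta>>0. \<exists>L\<ge>0. \<forall>x'\<in>P \<inter> ball x \<delta>. \<forall>x''\<in>P \<inter> ball x \<delta>.
        \<forall>t\<in>{0..T}. norm (\<phi> x' t - \<phi> x'' t) \<le> L * norm (x' - x'')"
    and lip_a: "locally_lipschitz_on P a"
    and cont_b: "continuous_on P b"
    and growth: "\<And>x t. x \<in> P \<Longrightarrow> 0 \<le> t \<Longrightarrow> b x + t \<le> a (\<phi> x t)"
    and \<kappa>: "\<kappa> < 1"
begin

definition W :: "'a \<Rightarrow> real" where
  "W x = (INF t\<in>{0..}. a (\<phi> x t) - \<kappa> * t)"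

lemma growth_discounted: "b x + (1 - \<kappa>) * t \<le> a (\<phi> x t) - \<kappa> * t" if "x \<in> P" "0 \<le> t"
  using growth[OF that] by (simp add: algebra_simps)

lemma bdd_below_along_trajectory: "x \<in> P \<Longrightarrow> bdd_below ((\<lambda>t. a (\<phi> x t) - \<kappa> * t) ` {0..})"
proof (rule bdd_belowI2)
  fix t :: real assume "x \<in> P" "t \<in> {0..}"
  moreover from this have "0 \<le> (1 - \<kappa>) * t" using \<kappa> by simp
  ultimately show "b x \<le> a (\<phi> x t) - \<kappa> * t" using growth_discounted[of x t] by simp
qed

lemma W_le: "x \<in> P \<Longrightarrow> 0 \<le> t \<Longrightarrow> W x \<le> a (\<phi> x t) - \<kappa> * t"
  unfolding W_def by (rule cINF_lower[OF bdd_below_along_trajectory]) auto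

lemma W_le_a: "x \<in> P \<Longrightarrow> W x \<le> a x"
  using W_le[of x 0] init[of x] by simp

lemma W_greatest: "(\<And>t. 0 \<le> t \<Longrightarrow> c \<le> a (\<phi> x t) - \<kappa> * t) \<Longrightarrow> c \<le> W x"
  unfolding W_def by (rule cINF_greatest) auto

lemma b_le_W: "x \<in> P \<Longrightarrow> b x \<le> W x"
proof (rule W_greatest)
  fix t :: real assume "x \<in> P" "0 \<le> t"
  moreover from this have "0 \<le> (1 - \<kappa>) * t" using \<kappa> by simp
  ultimately show "b x \<le> a (\<phi> x t) - \<kappa> * t" using growth_discounted[of x t] by simp
qed

lemma W_increases: "x \<in> P \<Longrightarrow> 0 \<le> s \<Longrightarrow> W x + \<kappa> * s \<le> W (\<phi> x s)"
proof (rule W_greatest)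
  fix t :: real assume *: "x \<in> P" "0 \<le> s" "0 \<le> t"
  then show "W x + \<kappa> * s \<le> a (\<phi> (\<phi> x s) t) - \<kappa> * t"
    using W_le[of x "s + t"] semi[of x s t] by (simp add: algebra_simps)
qed

text \<open>
  Near \<open>x\<close> the gap \<open>a - b\<close> is at most \<open>M\<close>, and times beyond \<open>T = M / (1 - \<kappa>)\<close> cannot beat the time \<open>0\<close>. For times up
  to \<open>T\<close> the terms of the infimum are Lipschitz in the starting point with the common constant \<open>La * L\<close>.
\<close>

lemma W_locally_lipschitz: "locally_lipschitz_on P W"
  unfolding locally_lipschitz_on_def
proof
  fix x assume x: "x \<in> P"
  define M where "M = a x - b x + 1"
  have "continuous_on P (\<lambda>x. a x - b x)"
    by (intro continuous_on_diff locally_lipschitz_on_imp_continuous_on[OF lip_a] cont_b)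
  then obtain \<delta>1 where \<delta>1: "\<delta>1 > 0" and gap': "\<And>x'. x' \<in> P \<Longrightarrow> dist x' x < \<delta>1 \<Longrightarrow> dist (a x' - b x') (a x - b x) < 1"
    using x unfolding continuous_on_iff by (metis zero_less_one)
  have gap: "a x' - b x' \<le> M" if "x' \<in> P" "dist x x' < \<delta>1" for x'
    using gap'[of x'] that by (simp add: M_def dist_commute dist_real_def)
  have M: "0 \<le> M" using growth[of x 0] init[OF x] x by (simp add: M_def)
  define T where "T = M / (1 - \<kappa>)"
  have T: "0 \<le> T" "(1 - \<kappa>) * T = M" using M \<kappa> by (auto simp: T_def)
  obtain \<delta>2 L where \<delta>2: "\<delta>2 > 0" and L: "0 \<le> L"
    and flow: "\<forall>x'\<in>P \<inter> ball x \<delta>2. \<forall>x''\<in>P \<inter> ball x \<delta>2.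
        \<forall>t\<in>{0..T}. norm (\<phi> x' t - \<phi> x'' t) \<le> L * norm (x' - x'')"
    using lip\<phi>[OF x T(1)] by blast
  have "continuous_on {0..T} (\<lambda>t. (\<lambda>(x, t). \<phi> x t) (x, t))"
    by (rule continuous_on_compose2[OF cont\<phi>]) (use x in \<open>auto intro!: continuous_intros\<close>)
  then have "compact (\<phi> x ` {0..T})" by (intro compact_continuous_image) auto
  then obtain u La where u: "u > 0" and La: "0 \<le> La"
    and Lau: "\<And>p. p \<in> \<phi> x ` {0..T} \<Longrightarrow> La-lipschitz_on (ball p u \<inter> P) a"
    by (rule lipschitz_near_compact[OF lip_a]) (use inv[OF x] in auto)
  obtain \<delta>3 where \<delta>3: "\<delta>3 > 0"
    "\<And>x' t. x' \<in> P \<Longrightarrow> dist x x' < \<delta>3 \<Longrightarrow> 0 \<le> t \<Longrightarrow> t \<le> T \<Longrightarrow> dist (\<phi> x' t) (\<phi> x t) \<le> u / 2"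
    using flow_uniformly_continuous_initial[OF cont\<phi> x, of "u / 2" T] u by auto
  define \<delta> where "\<delta> = min \<delta>1 (min \<delta>2 \<delta>3) / 2"
  have \<delta>: "0 < \<delta>" "\<delta> < \<delta>1" "\<delta> < \<delta>2" "\<delta> < \<delta>3" using \<delta>1 \<delta>2 \<delta>3 by (auto simp: \<delta>_def min_def)
  have le: "W x'' - La * L * norm (x' - x'') \<le> W x'"
    if x': "x' \<in> P" "dist x x' \<le> \<delta>" and x'': "x'' \<in> P" "dist x x'' \<le> \<delta>" for x' x''
  proof (rule W_greatest)
    fix t :: real assume t: "0 \<le> t"
    have early: "W x'' - La * L * norm (x' - x'') \<le> a (\<phi> x' t) - \<kappa> * t" if t: "0 \<le> t" "t \<le> T" for t
    proof -
      have near: "\<phi> z t \<in> ball (\<phi> x t) u \<inter> P" if "z \<in> P" "dist x z \<le> \<delta>" for z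
        using \<delta>3(2)[of z t] that t u \<delta> inv[of z t] by (auto simp: dist_commute)
      have "\<phi> x t \<in> \<phi> x ` {0..T}" using t by auto
      then have "norm (a (\<phi> x'' t) - a (\<phi> x' t)) \<le> La * norm (\<phi> x'' t - \<phi> x' t)"
        by (rule lipschitz_on_normD[OF Lau near near]) (use x' x'' in auto)
      also have "\<dots> \<le> La * (L * norm (x'' - x'))"
        using flow x' x'' t \<delta> La by (intro mult_left_mono) auto
      finally have "a (\<phi> x'' t) \<le> a (\<phi> x' t) + La * L * norm (x' - x'')"
        by (simp add: norm_minus_commute mult.assoc)
      then show ?thesis using W_le[OF x''(1) t(1)] by linarith
    qed
    show "W x'' - La * L * norm (x' - x'') \<le> a (\<phi> x' t) - \<kappa> * t"
    proof (cases "t \<le> T")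
      case True
      then show ?thesis using early t by simp
    next
      case False
      then have "(1 - \<kappa>) * T \<le> (1 - \<kappa>) * t" using \<kappa> by (intro mult_left_mono) auto
      then have "a x' \<le> a (\<phi> x' t) - \<kappa> * t"
        using growth_discounted[OF x'(1) t] gap[of x'] x' \<delta> T(2) by simp
      moreover have "W x'' - La * L * norm (x' - x'') \<le> a x'"
        using early[of 0] T(1) init[OF x'(1)] by simp
      ultimately show ?thesis by linarith
    qed
  qed
  have "(La * L)-lipschitz_on (cball x \<delta> \<inter> P) W"
  proof (rule lipschitz_onI)
    fix x' x'' assume "x' \<in> cball x \<delta> \<inter> P" "x'' \<in> cball x \<delta> \<inter> P"
    then have "W x'' - La * L * norm (x' - x'') \<le> W x'" "W x' - La * L * norm (x'' - x') \<le> W x''"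
      by (auto intro!: le)
    then show "dist (W x') (W x'') \<le> La * L * dist x' x''"
      unfolding dist_real_def dist_norm norm_minus_commute[of x'' x'] by linarith
  qed (use L La in simp)
  then show "\<exists>u>0. \<exists>L. L-lipschitz_on (cball x u \<inter> P) W" using \<delta>(1) by blast
qed

end

lemma has_real_derivative_nonneg_at_left_endpoint:
  fixes q :: "real \<Rightarrow> real"
  assumes der: "(q has_real_derivative D) (at 0 within {0..})" and "q 0 = 0"
    and nonneg: "\<And>s. 0 \<le> s \<Longrightarrow> 0 \<le> q s"
  shows "0 \<le> D"
proof (rule tendsto_lowerbound)
  show "((\<lambda>s. (q s - q 0) / (s - 0)) \<longlongrightarrow> D) (at 0 within {0..})"
    using der unfolding has_field_derivative_iff .
  show "\<forall>\<^sub>F s in at 0 within {0..}. 0 \<le> (q s - q 0) / (s - 0)"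
    using nonneg \<open>q 0 = 0\<close> by (auto simp: eventually_at_filter)
  show "at (0::real) within {0..} \<noteq> bot"
  proof -
    have "{0..} - {0} = {0::real<..}" by auto
    then show ?thesis by (simp add: at_within_eq_bot_iff)
  qed
qed

text \<open>
  A Lipschitz bound for the inverse of \<open>\<tau>\<close>, in a form that does not name the inverse.
\<close>

lemma dist_le_by_inverse_derivative:
  fixes \<tau> \<rho> :: "real \<Rightarrow> real"
  assumes der: "\<And>y. c \<le> y \<Longrightarrow> y \<le> d \<Longrightarrow> (\<tau> has_real_derivative 1 / \<rho> y) (at y)"
    and bound: "\<And>y. c \<le> y \<Longrightarrow> y \<le> d \<Longrightarrow> \<rho> y \<noteq> 0 \<and> \<bar>\<rho> y\<bar> \<le> R"
    and "y \<in> {c..d}" "z \<in> {c..d}"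
  shows "\<bar>y - z\<bar> \<le> R * \<bar>\<tau> y - \<tau> z\<bar>"
proof -
  have *: "\<bar>y - z\<bar> \<le> R * \<bar>\<tau> y - \<tau> z\<bar>" if yz: "c \<le> y" "y < z" "z \<le> d" for y z
  proof -
    obtain \<xi> where \<xi>: "y < \<xi>" "\<xi> < z" "\<tau> z - \<tau> y = (z - y) * (1 / \<rho> \<xi>)"
      using MVT2[of y z \<tau> "\<lambda>y. 1 / \<rho> y"] der yz by auto
    then have b: "\<rho> \<xi> \<noteq> 0" "\<bar>\<rho> \<xi>\<bar> \<le> R" using bound[of \<xi>] yz by auto
    then have "z - y = \<rho> \<xi> * (\<tau> z - \<tau> y)" using \<xi> by simp
    then have "\<bar>z - y\<bar> = \<bar>\<rho> \<xi>\<bar> * \<bar>\<tau> z - \<tau> y\<bar>" by (simp add: abs_mult)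
    also have "\<dots> \<le> R * \<bar>\<tau> z - \<tau> y\<bar>" using b by (intro mult_right_mono) auto
    finally show ?thesis by (simp add: abs_minus_commute)
  qed
  consider "y < z" | "y = z" | "z < y" by linarith
  then show ?thesis
    using *[of y z] *[of z y] assms(3,4) by cases (auto simp: abs_minus_commute)
qed

section \<open>The converse Lyapunov theorem\<close>

theorem theorem20:
  fixes \<Omega> G :: "(real^'n) set"
    and f :: "real^'n \<Rightarrow> real^'n"
    and \<phi> :: "real^'n \<Rightarrow> real \<Rightarrow> real^'n"
    and \<alpha>\<^sub>1 \<alpha>\<^sub>2 :: "real^'n \<Rightarrow> real"
    and \<rho> :: "real \<Rightarrow> real"
    and \<beta> :: "real \<Rightarrow> real \<Rightarrow> real"
  assumes "0 \<in> \<Omega>" and "f 0 = 0"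
    and "is_solution_map \<Omega> f \<phi>"
    and "G \<subseteq> \<Omega>" and "forward_invariant \<phi> G"
    and "continuous_on G \<alpha>\<^sub>1" and "\<forall>x\<in>G. \<alpha>\<^sub>1 x \<ge> 0"
    and "continuous_on G \<alpha>\<^sub>2" and "\<forall>x\<in>G. \<alpha>\<^sub>2 x \<ge> 0"
    and "continuous_on {0<..} \<rho>"
    and "is_unique_rate_flow \<rho> \<beta>"
    and "positive_definite_on G \<alpha>\<^sub>1" and "coercive_on G \<alpha>\<^sub>1"
    and "\<forall>y>0. strict_antimono_on {0..} (\<beta> y)"
    and "locally_lipschitz_on \<Omega> f"
    and "locally_lipschitz_on G \<alpha>\<^sub>1"
    and "locally_lipschitz_on ({0..} \<times> {0..}) (\<lambda>(y, t). \<beta> y t)"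
    and "beta_stable_on G \<phi> \<beta> \<alpha>\<^sub>1 \<alpha>\<^sub>2"
  shows "\<forall>\<epsilon>. 0 < \<epsilon> \<and> \<epsilon> < 1 \<longrightarrow>
    (\<exists>V :: real^'n \<Rightarrow> real.
       continuous_on G V \<and> (\<forall>x\<in>G. V x \<ge> 0) \<and>
       locally_lipschitz_on (G - {0}) V \<and>
       (AE x\<in>G in lebesgue. V differentiable (at x within G)) \<and>
       (\<forall>x\<in>G. \<alpha>\<^sub>1 x \<le> V x \<and> V x \<le> \<alpha>\<^sub>2 x) \<and>
       (AE x\<in>G in lebesgue. \<forall>v. has_gradient_within V v x G \<longrightarrow>
          v \<bullet> f x \<le> (1 - \<epsilon>) * \<rho> (V x)))"
proof (intro allI impI)
  fix \<epsilon> :: real assume "0 < \<epsilon> \<and> \<epsilon> < 1"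
  then have \<epsilon>: "0 < \<epsilon>" "\<epsilon> < 1" by auto
  define \<kappa> where "\<kappa> = 1 - \<epsilon>"
  have \<kappa>01: "0 < \<kappa>" "\<kappa> < 1" using \<epsilon> by (auto simp: \<kappa>_def)
  define P where "P = G - {0}"

  have rf: "rate_flow \<rho> \<beta>" using \<open>is_unique_rate_flow \<rho> \<beta>\<close> by (simp add: is_unique_rate_flow_def)
  note dec = \<open>\<forall>y>0. strict_antimono_on {0..} (\<beta> y)\<close>
  have \<beta>0: "\<beta> y 0 = y" if "0 \<le> y" for y using rf that by (simp add: rate_flow_def)
  have \<rho>neg: "\<rho> y < 0" if "0 < y" for y
    by (rule rate_negative) (use that assms in auto)
  obtain \<tau> where der\<tau>: "\<And>y. 0 < y \<Longrightarrow> (\<tau> has_real_derivative 1 / \<rho> y) (at y)"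
    and \<tau>\<beta>: "\<And>y t. 0 < y \<Longrightarrow> 0 \<le> t \<Longrightarrow> \<tau> (\<beta> y t) = \<tau> y + t"
    using rate_time_coordinate[OF rf dec \<open>continuous_on {0<..} \<rho>\<close> \<rho>neg] by blast
  have \<tau>less: "\<tau> z < \<tau> y" if "0 < y" "y < z" for y z
    by (rule DERIV_neg_imp_decreasing[OF that(2)]) (use der\<tau> \<rho>neg that in \<open>meson divide_pos_neg less_le_trans zero_less_one\<close>)
  have \<tau>le: "\<tau> z \<le> \<tau> y" if "0 < y" "y \<le> z" for y z
    using \<tau>less[of y z] that by (cases "y = z") auto
  have \<tau>leD: "z \<le> y" if "\<tau> y \<le> \<tau> z" "0 < y" "0 < z" for y z
    using \<tau>less[of y z] that by fastforce

  have traj: "\<phi> x 0 = x" "\<And>t. 0 \<le> t \<Longrightarrow> \<phi> x t \<in> \<Omega>"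
    "\<And>t. 0 \<le> t \<Longrightarrow> (\<phi> x has_vector_derivative f (\<phi> x t)) (at t within {0..})" if "x \<in> \<Omega>" for x
    using \<open>is_solution_map \<Omega> f \<phi>\<close> that unfolding is_solution_map_def ode_solution_def by auto
  have cont\<Omega>: "continuous_on (\<Omega> \<times> {0..}) (\<lambda>(x, t). \<phi> x t)"
    using \<open>is_solution_map \<Omega> f \<phi>\<close> by (simp add: is_solution_map_def)
  have invG: "\<phi> x t \<in> G" if "x \<in> G" "0 \<le> t" for x t
    using \<open>forward_invariant \<phi> G\<close> that by (simp add: forward_invariant_def)
  have invP: "\<phi> x t \<in> P" if "x \<in> P" "0 \<le> t" for x t
    using flow_avoids_equilibrium[of \<Omega> f \<phi> x t] assms invG[of x t] that unfolding P_def by blast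
  have \<phi>0: "\<phi> 0 t = 0" if "0 \<le> t" for t
  proof -
    have "ode_solution \<Omega> f 0 (\<lambda>_. 0)"
      using \<open>0 \<in> \<Omega>\<close> \<open>f 0 = 0\<close> by (simp add: ode_solution_def)
    then show ?thesis
      using \<open>is_solution_map \<Omega> f \<phi>\<close> \<open>0 \<in> \<Omega>\<close> that unfolding is_solution_map_def by metis
  qed

  have \<alpha>pos: "0 < \<alpha>\<^sub>1 x" if "x \<in> P" for x
    using \<open>positive_definite_on G \<alpha>\<^sub>1\<close> \<open>\<forall>x\<in>G. \<alpha>\<^sub>1 x \<ge> 0\<close> that
    unfolding positive_definite_on_def P_def by (metis DiffE insertI1 order_le_less)
  have stable: "\<alpha>\<^sub>1 (\<phi> x t) \<le> \<beta> (\<alpha>\<^sub>2 x) t" if "x \<in> G" "0 \<le> t" for x t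
    using \<open>beta_stable_on G \<phi> \<beta> \<alpha>\<^sub>1 \<alpha>\<^sub>2\<close> that by (simp add: beta_stable_on_def)
  have \<alpha>le: "\<alpha>\<^sub>1 x \<le> \<alpha>\<^sub>2 x" if "x \<in> G" for x
    using stable[OF that, of 0] traj(1)[of x] \<beta>0[of "\<alpha>\<^sub>2 x"] assms that by auto
  have \<alpha>2pos: "0 < \<alpha>\<^sub>2 x" if "x \<in> P" for x
    using \<alpha>pos[OF that] \<alpha>le[of x] that by (auto simp: P_def)

  define a where "a = (\<lambda>x. \<tau> (\<alpha>\<^sub>1 x))"
  define b where "b = (\<lambda>x. \<tau> (\<alpha>\<^sub>2 x))"
  have growth: "b x + t \<le> a (\<phi> x t)" if "x \<in> P" "0 \<le> t" for x t
  proof -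
    have "b x + t = \<tau> (\<beta> (\<alpha>\<^sub>2 x) t)" using \<tau>\<beta> \<alpha>2pos that by (simp add: b_def)
    also have "\<dots> \<le> a (\<phi> x t)"
      unfolding a_def by (rule \<tau>le) (use that stable \<alpha>pos invP in \<open>auto simp: P_def\<close>)
    finally show ?thesis .
  qed
  have cont\<rho>': "continuous_on {0<..} (\<lambda>y. 1 / \<rho> y)"
    using \<rho>neg by (intro continuous_intros assms) (auto simp: less_imp_neq)
  have cont\<tau>: "continuous_on {0<..} \<tau>"
    by (intro locally_lipschitz_on_imp_continuous_on C1_locally_lipschitz_on_pos[OF der\<tau> cont\<rho>'])

  interpret trajectory_infimum P \<phi> a b \<kappa>
  proof
    show "\<phi> x t \<in> P" if "x \<in> P" "0 \<le> t" for x t using invP that .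
    show "\<phi> x 0 = x" if "x \<in> P" for x using traj(1) that assms by (auto simp: P_def)
    show "\<phi> (\<phi> x s) t = \<phi> x (s + t)" if "x \<in> P" "0 \<le> s" "0 \<le> t" for x s t
      using assms that unfolding is_solution_map_def P_def by blast
    show "continuous_on (P \<times> {0..}) (\<lambda>(x, t). \<phi> x t)"
      by (rule continuous_on_subset[OF cont\<Omega>]) (use assms in \<open>auto simp: P_def\<close>)
    show "\<exists>\<delta>>0. \<exists>L\<ge>0. \<forall>x'\<in>P \<inter> ball x \<delta>. \<forall>x''\<in>P \<inter> ball x \<delta>.
        \<forall>t\<in>{0..T}. norm (\<phi> x' t - \<phi> x'' t) \<le> L * norm (x' - x'')" if "x \<in> P" "0 \<le> T" for x T
    proof -
      have P\<Omega>: "P \<subseteq> \<Omega>" using assms by (auto simp: P_def)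
      then have "x \<in> \<Omega>" using that by auto
      then obtain \<delta> L where "\<delta> > 0" "0 \<le> L"
        "\<And>x' x'' t. x' \<in> \<Omega> \<Longrightarrow> dist x x' < \<delta> \<Longrightarrow> x'' \<in> \<Omega> \<Longrightarrow> dist x x'' < \<delta> \<Longrightarrow> 0 \<le> t \<Longrightarrow> t \<le> T \<Longrightarrow>
          norm (\<phi> x' t - \<phi> x'' t) \<le> L * norm (x' - x'')"
        using flow_locally_lipschitz_initial[OF \<open>is_solution_map \<Omega> f \<phi>\<close> \<open>locally_lipschitz_on \<Omega> f\<close> _ \<open>0 \<le> T\<close>]
        by blast
      then show ?thesis using P\<Omega> by (intro exI[of _ \<delta>] exI[of _ L] conjI ballI) auto
    qed
    show "locally_lipschitz_on P a"
      unfolding a_def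
      by (rule locally_lipschitz_on_compose[OF _ C1_locally_lipschitz_on_pos[OF der\<tau> cont\<rho>']])
         (use \<alpha>pos assms in \<open>auto intro: locally_lipschitz_on_subset simp: P_def\<close>)
    show "continuous_on P b"
      unfolding b_def
      by (rule continuous_on_compose2[OF cont\<tau>])
         (use \<alpha>2pos assms in \<open>auto intro: continuous_on_subset simp: P_def\<close>)
    show "b x + t \<le> a (\<phi> x t)" if "x \<in> P" "0 \<le> t" for x t using growth that .
    show "\<kappa> < 1" by (rule \<kappa>01(2))
  qed

  have "\<exists>v. \<alpha>\<^sub>1 x \<le> v \<and> v \<le> \<alpha>\<^sub>2 x \<and> \<tau> v = W x" if "x \<in> P" for x
  proof -
    have "\<exists>v\<ge>\<alpha>\<^sub>1 x. v \<le> \<alpha>\<^sub>2 x \<and> \<tau> v = W x"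
    proof (rule IVT2')
      show "\<tau> (\<alpha>\<^sub>2 x) \<le> W x" "W x \<le> \<tau> (\<alpha>\<^sub>1 x)"
        using b_le_W[OF that] W_le_a[OF that] by (auto simp: a_def b_def)
      show "continuous_on {\<alpha>\<^sub>1 x..\<alpha>\<^sub>2 x} \<tau>"
        by (rule continuous_on_subset[OF cont\<tau>]) (use \<alpha>pos[OF that] in auto)
    qed (use \<alpha>le that in \<open>auto simp: P_def\<close>)
    then show ?thesis by blast
  qed
  then obtain V0 where V0: "\<And>x. x \<in> P \<Longrightarrow> \<alpha>\<^sub>1 x \<le> V0 x" "\<And>x. x \<in> P \<Longrightarrow> V0 x \<le> \<alpha>\<^sub>2 x"
    "\<And>x. x \<in> P \<Longrightarrow> \<tau> (V0 x) = W x"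
    by metis
  define V where "V = (\<lambda>x. if x = 0 then 0 else V0 x)"
  have VP: "\<alpha>\<^sub>1 x \<le> V x" "V x \<le> \<alpha>\<^sub>2 x" "\<tau> (V x) = W x" "0 < V x" if "x \<in> P" for x
    using V0[OF that] \<alpha>pos[OF that] that by (auto simp: V_def P_def)

  have V_bounds: "\<alpha>\<^sub>1 x \<le> V x \<and> V x \<le> \<alpha>\<^sub>2 x" if "x \<in> G" for x
  proof (cases "x = 0")
    case True
    then show ?thesis using assms that by (auto simp: V_def positive_definite_on_def)
  next
    case False
    then show ?thesis using VP[of x] that by (auto simp: P_def)
  qed

  have V_lip: "locally_lipschitz_on P V"
    unfolding locally_lipschitz_on_def
  proof
    fix x assume x: "x \<in> P"
    define c where "c = \<alpha>\<^sub>1 x / 2"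
    define d where "d = \<alpha>\<^sub>2 x + 1"
    have c: "0 < c" using \<alpha>pos[OF x] by (simp add: c_def)
    have xG: "x \<in> G" using x by (simp add: P_def)
    obtain \<delta>1 where \<delta>1: "\<delta>1 > 0" "\<And>z. z \<in> G \<Longrightarrow> dist z x < \<delta>1 \<Longrightarrow> dist (\<alpha>\<^sub>1 z) (\<alpha>\<^sub>1 x) < c"
      using \<open>continuous_on G \<alpha>\<^sub>1\<close> xG c unfolding continuous_on_iff by metis
    obtain \<delta>2 where \<delta>2: "\<delta>2 > 0" "\<And>z. z \<in> G \<Longrightarrow> dist z x < \<delta>2 \<Longrightarrow> dist (\<alpha>\<^sub>2 z) (\<alpha>\<^sub>2 x) < 1"
      using \<open>continuous_on G \<alpha>\<^sub>2\<close> xG zero_less_one unfolding continuous_on_iff by metis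
    obtain u L where u: "u > 0" and L: "L-lipschitz_on (cball x u \<inter> P) W"
      using W_locally_lipschitz x unfolding locally_lipschitz_on_def by blast
    have "bounded (\<rho> ` {c..d})"
      by (intro compact_imp_bounded compact_continuous_image continuous_on_subset[OF \<open>continuous_on {0<..} \<rho>\<close>])
         (use c in auto)
    then obtain R where R: "R > 0" "\<forall>r\<in>\<rho> ` {c..d}. norm r \<le> R" unfolding bounded_pos by blast
    define \<delta> where "\<delta> = min u (min \<delta>1 \<delta>2) / 2"
    have \<delta>: "0 < \<delta>" "\<delta> < u" "\<delta> < \<delta>1" "\<delta> < \<delta>2" using u \<delta>1(1) \<delta>2(1) by (auto simp: \<delta>_def min_def)
    have range: "V z \<in> {c..d}" if "z \<in> cball x \<delta> \<inter> P" for z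
    proof -
      have "z \<in> G" "dist z x < \<delta>1" "dist z x < \<delta>2" using that \<delta> by (auto simp: P_def dist_commute)
      then have "\<bar>\<alpha>\<^sub>1 z - \<alpha>\<^sub>1 x\<bar> < c" "\<bar>\<alpha>\<^sub>2 z - \<alpha>\<^sub>2 x\<bar> < 1" using \<delta>1(2) \<delta>2(2) by (auto simp: dist_real_def)
      then have "c \<le> \<alpha>\<^sub>1 z" "\<alpha>\<^sub>2 z \<le> d" unfolding c_def d_def by linarith+
      then show ?thesis using VP(1,2)[of z] that by auto
    qed
    have "(R * L)-lipschitz_on (cball x \<delta> \<inter> P) V"
    proof (rule lipschitz_onI)
      fix y z assume y: "y \<in> cball x \<delta> \<inter> P" and z: "z \<in> cball x \<delta> \<inter> P"
      have "dist (V y) (V z) \<le> R * \<bar>\<tau> (V y) - \<tau> (V z)\<bar>"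
        unfolding dist_real_def
      proof (rule dist_le_by_inverse_derivative[OF _ _ range[OF y] range[OF z]])
        fix w assume w: "c \<le> w" "w \<le> d"
        then have "0 < w" using c by simp
        then show "(\<tau> has_real_derivative 1 / \<rho> w) (at w)" by (rule der\<tau>)
        have "norm (\<rho> w) \<le> R" using R(2) w by simp
        then show "\<rho> w \<noteq> 0 \<and> \<bar>\<rho> w\<bar> \<le> R" using \<rho>neg[OF \<open>0 < w\<close>] by simp
      qed
      also have "\<dots> = R * dist (W y) (W z)" using VP(3) y z by (simp add: dist_real_def)
      also have "\<dots> \<le> R * (L * dist y z)"
        using R(1) y z \<delta> by (intro mult_left_mono lipschitz_onD[OF L]) auto
      finally show "dist (V y) (V z) \<le> R * L * dist y z" by (simp add: mult.assoc)
    qed (use R(1) lipschitz_on_nonneg[OF L] in simp)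
    then show "\<exists>u>0. \<exists>L. L-lipschitz_on (cball x u \<inter> P) V" using \<delta>(1) by blast
  qed

  have within: "at x within P = at x within G" if "x \<noteq> 0" for x
    by (rule at_within_nhd[of _ "- {0}"]) (use that in \<open>auto simp: P_def\<close>)

  have V_cont0: "continuous (at 0 within G) V" if zG: "0 \<in> G"
    unfolding continuous_within_eps_delta
  proof (intro allI impI)
    fix e :: real assume e: "0 < e"
    (* If W >= N near 0, then V < e there. The time T bounds the relevant times, and states with
    alpha_1 below the level theta have time coordinate at least N + kappa * T. *)
    define N where "N = \<tau> e + 1"
    define D where "D = \<alpha>\<^sub>2 0 + 1"
    define T where "T = max 0 ((N - \<tau> D) / (1 - \<kappa>))"
    have T: "0 \<le> T" "(N - \<tau> D) \<le> (1 - \<kappa>) * T" using \<kappa>01 by (auto simp: T_def field_simps max_def)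
    define \<theta> where "\<theta> = \<beta> 1 (max 0 (N + \<kappa> * T - \<tau> 1))"
    have \<theta>: "0 < \<theta>" "N + \<kappa> * T \<le> \<tau> \<theta>"
      using rate_flow_pos[OF rf dec, of 1] \<tau>\<beta>[of 1] by (auto simp: \<theta>_def)
    obtain \<delta>1 where \<delta>1: "\<delta>1 > 0" "\<And>z. z \<in> G \<Longrightarrow> dist z 0 < \<delta>1 \<Longrightarrow> dist (\<alpha>\<^sub>2 z) (\<alpha>\<^sub>2 0) < 1"
      using \<open>continuous_on G \<alpha>\<^sub>2\<close> zG zero_less_one unfolding continuous_on_iff by metis
    obtain r where r: "r > 0" "\<And>z. z \<in> G \<Longrightarrow> dist z 0 < r \<Longrightarrow> dist (\<alpha>\<^sub>1 z) (\<alpha>\<^sub>1 0) < \<theta>"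
      using \<open>continuous_on G \<alpha>\<^sub>1\<close> zG \<theta>(1) unfolding continuous_on_iff by metis
    have \<alpha>10: "\<alpha>\<^sub>1 0 = 0" using \<open>positive_definite_on G \<alpha>\<^sub>1\<close> zG by (simp add: positive_definite_on_def)
    obtain \<delta>2 where \<delta>2: "\<delta>2 > 0"
      "\<And>x' t. x' \<in> \<Omega> \<Longrightarrow> dist 0 x' < \<delta>2 \<Longrightarrow> 0 \<le> t \<Longrightarrow> t \<le> T \<Longrightarrow> dist (\<phi> x' t) (\<phi> 0 t) \<le> r / 2"
      using flow_uniformly_continuous_initial[OF cont\<Omega> \<open>0 \<in> \<Omega>\<close>, of "r / 2" T] r by auto
    have "dist (V z) (V 0) < e" if z: "z \<in> G" "dist z 0 < min \<delta>1 \<delta>2" for z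
    proof (cases "z = 0")
      case True
      then show ?thesis using e by simp
    next
      case False
      then have zP: "z \<in> P" using z by (simp add: P_def)
      have z\<Omega>: "z \<in> \<Omega>" using z \<open>G \<subseteq> \<Omega>\<close> by auto
      have "\<tau> D \<le> b z"
        unfolding b_def using \<delta>1(2)[OF z(1)] z(2) \<alpha>2pos[OF zP]
        by (intro \<tau>le) (auto simp: D_def dist_real_def)
      have "N \<le> W z"
      proof (rule W_greatest)
        fix t :: real assume t: "0 \<le> t"
        show "N \<le> a (\<phi> z t) - \<kappa> * t"
        proof (cases "t \<le> T")
          case True
          have "dist (\<phi> z t) 0 < r"
            using \<delta>2(2)[OF z\<Omega> _ t True] \<phi>0[OF t] z(2) r(1) by (simp add: dist_commute)
          then have "\<alpha>\<^sub>1 (\<phi> z t) \<le> \<theta>" using r(2)[OF invG[OF z(1) t]] \<alpha>10 by (simp add: dist_real_def)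
          then have "\<tau> \<theta> \<le> a (\<phi> z t)" unfolding a_def by (intro \<tau>le \<alpha>pos invP zP t)
          moreover have "\<kappa> * t \<le> \<kappa> * T" using True \<kappa>01 by (intro mult_left_mono) auto
          ultimately show ?thesis using \<theta>(2) by linarith
        next
          case False
          then have "(1 - \<kappa>) * T \<le> (1 - \<kappa>) * t" using \<kappa>01 by (intro mult_left_mono) auto
          then show ?thesis using growth_discounted[OF zP t] T(2) \<open>\<tau> D \<le> b z\<close> by linarith
        qed
      qed
      then have "\<tau> e < \<tau> (V z)" using VP(3)[OF zP] by (simp add: N_def)
      then have "V z < e" using \<tau>le[OF e, of "V z"] by linarith
      then show ?thesis using VP(4)[OF zP] by (simp add: V_def dist_real_def)
    qed
    then show "\<exists>d>0. \<forall>x'\<in>G. dist x' 0 < d \<longrightarrow> dist (V x') (V 0) < e"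
      using \<delta>1(1) \<delta>2(1) by (intro exI[of _ "min \<delta>1 \<delta>2"]) auto
  qed

  have V_cont: "continuous_on G V"
    unfolding continuous_on_eq_continuous_within
  proof
    fix x assume x: "x \<in> G"
    show "continuous (at x within G) V"
    proof (cases "x = 0")
      case True
      then show ?thesis using V_cont0 x by simp
    next
      case False
      then have "continuous (at x within P) V"
        using locally_lipschitz_on_imp_continuous_on[OF V_lip] x
        by (auto simp: continuous_on_eq_continuous_within P_def)
      then show ?thesis using within[OF False] by simp
    qed
  qed

  have V_decrease: "v \<bullet> f x \<le> \<kappa> * \<rho> (V x)" if x: "x \<in> P" and v: "has_gradient_within V v x G" for x v
  proof -
    have x\<Omega>: "x \<in> \<Omega>" and xG: "x \<in> G" using x \<open>G \<subseteq> \<Omega>\<close> by (auto simp: P_def)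
    (* The scalar flow slowed down by the factor kappa dominates V along the trajectory, and both
    start at V x. *)
    define q where "q = (\<lambda>s. \<beta> (V x) (\<kappa> * s) - V (\<phi> x s))"
    have q_nonneg: "0 \<le> q s" if s: "0 \<le> s" for s
    proof -
      have "\<tau> (\<beta> (V x) (\<kappa> * s)) = W x + \<kappa> * s"
        using \<tau>\<beta>[OF VP(4)[OF x], of "\<kappa> * s"] VP(3)[OF x] \<kappa>01 s by simp
      also have "\<dots> \<le> \<tau> (V (\<phi> x s))" using W_increases[OF x s] VP(3)[OF invP[OF x s]] by simp
      finally show ?thesis
        unfolding q_def using \<tau>leD rate_flow_pos[OF rf dec VP(4)[OF x], of "\<kappa> * s"] VP(4)[OF invP[OF x s]] \<kappa>01 s
        by simp
    qed
    have q0: "q 0 = 0" using traj(1)[OF x\<Omega>] \<beta>0[of "V x"] VP(4)[OF x] by (simp add: q_def)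
    have q_der: "(q has_real_derivative (\<kappa> * \<rho> (V x) - v \<bullet> f x)) (at 0 within {0..})"
    proof -
      have "(\<phi> x has_derivative (\<lambda>h. h *\<^sub>R f x)) (at 0 within {0..})"
        using traj(3)[OF x\<Omega>, of 0] traj(1)[OF x\<Omega>] by (simp add: has_vector_derivative_def)
      moreover have "(V has_derivative (\<lambda>h. v \<bullet> h)) (at (\<phi> x 0) within \<phi> x ` {0..})"
        using v unfolding has_gradient_within_def traj(1)[OF x\<Omega>]
        by (rule has_derivative_subset) (use invG xG in auto)
      ultimately have "((\<lambda>s. V (\<phi> x s)) has_derivative (\<lambda>h. v \<bullet> (h *\<^sub>R f x))) (at 0 within {0..})"
        by (rule has_derivative_in_compose)
      moreover have "(\<lambda>h. v \<bullet> (h *\<^sub>R f x)) = (*) (v \<bullet> f x)" by (auto simp: mult.commute)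
      ultimately have V\<phi>: "((\<lambda>s. V (\<phi> x s)) has_real_derivative (v \<bullet> f x)) (at 0 within {0..})"
        by (simp only: has_field_derivative_def)
      have "(\<beta> (V x) has_real_derivative \<rho> (V x)) (at 0 within {0..})"
        using rf VP(4)[OF x] \<beta>0[of "V x"] unfolding rate_flow_def by (metis less_imp_le order_refl)
      moreover have "(*) \<kappa> ` {0..} \<subseteq> {0..}" using \<kappa>01 by auto
      ultimately have "(\<beta> (V x) has_real_derivative \<rho> (V x)) (at (\<kappa> * 0) within (*) \<kappa> ` {0..})"
        using DERIV_subset by fastforce
      then have "((\<beta> (V x) \<circ> (*) \<kappa>) has_real_derivative (\<rho> (V x) * \<kappa>)) (at 0 within {0..})"
        by (rule DERIV_image_chain) (auto intro!: derivative_eq_intros)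
      from DERIV_diff[OF this V\<phi>] show ?thesis by (simp add: q_def o_def mult.commute)
    qed
    have "0 \<le> \<kappa> * \<rho> (V x) - v \<bullet> f x"
      by (rule has_real_derivative_nonneg_at_left_endpoint[OF q_der q0 q_nonneg])
    then show ?thesis by simp
  qed

  have ae0: "AE x in lebesgue. x \<noteq> (0 :: real^'n)"
    by (rule AE_completion) (rule AE_lborel_singleton)
  have diff: "AE x\<in>G in lebesgue. V differentiable (at x within G)"
    using locally_lipschitz_differentiable_ae[OF V_lip] ae0
    by eventually_elim (auto simp: P_def within[unfolded P_def])
  have grad: "AE x\<in>G in lebesgue. \<forall>v. has_gradient_within V v x G \<longrightarrow> v \<bullet> f x \<le> (1 - \<epsilon>) * \<rho> (V x)"
    using ae0 by eventually_elim (use V_decrease in \<open>auto simp: P_def \<kappa>_def\<close>)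
  have "\<forall>x\<in>G. 0 \<le> V x" using V_bounds assms by force
  then show "\<exists>V :: real^'n \<Rightarrow> real.
       continuous_on G V \<and> (\<forall>x\<in>G. V x \<ge> 0) \<and>
       locally_lipschitz_on (G - {0}) V \<and>
       (AE x\<in>G in lebesgue. V differentiable (at x within G)) \<and>
       (\<forall>x\<in>G. \<alpha>\<^sub>1 x \<le> V x \<and> V x \<le> \<alpha>\<^sub>2 x) \<and>
       (AE x\<in>G in lebesgue. \<forall>v. has_gradient_within V v x G \<longrightarrow>
          v \<bullet> f x \<le> (1 - \<epsilon>) * \<rho> (V x))"
    using V_cont V_lip V_bounds diff grad unfolding P_def by blast
qed

end
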